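(* Let $q\ge 2$, let $m_0,k_0>0$ be real numbers, and for $i,j\in\{1,\dots,q\}$ let $m_{ij}=m_{ji}\ge 0$, $b_{ij}=b_{ji}\ge 0$, $k_{ij}=k_{ji}\ge 0$ be real numbers with $m_{ii}=b_{ii}=k_{ii}=0$. Consider the coupled harmonic oscillators with $x_1,\dots,x_q\in\mathbb{R}$, $$m_0\ddot x_i+k_0x_i+\sum_{j=1}^{q}m_{ij}(\ddot x_i-\ddot x_j)+\sum_{j=1}^{q}b_{ij}(\dot x_i-\dot x_j)+\sum_{j=1}^{q}k_{ij}(x_i-x_j)=0,\qquad i=1,\dots,q.$$ Let $M=\mathrm{lap}\,(m_{ij})_{i,j=1}^q$, $B=\mathrm{lap}\,(b_{ij})_{i,j=1}^q$, $K=\mathrm{lap}\,(k_{ij})_{i,j=1}^q$ be the associated Laplacian matrices, and let $\mathcal{M}=(\mathcal{V},\mathcal{E}_{\mathrm m})$ and $\mathcal{K}=(\mathcal{V},\mathcal{E}_{\mathrm k})$ be the graphs on $\mathcal{V}=\{v_1,\dots,v_q\}$ with edge sets $\mathcal{E}_{\mathrm m}=\{(v_i,v_j):m_{ij}>0\}$ and $\mathcal{E}_{\mathrm k}=\{(v_i,v_j):k_{ij}>0\}$. Suppose the graphs $\mathcal{M}$ and $\mathcal{K}$ are edge-isolated. Then the oscillators synchronize if and only if $\mathrm{Re}\,\lambda_2(B+\mathrm{j}(K-M))>0$, where $\mathrm{j}$ is the imaginary unit.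
   Context: For a real symmetric array $(a_{ij})_{i,j=1}^q$ with $a_{ij}\ge 0$ and $a_{ii}=0$, the Laplacian $\mathrm{lap}\,(a_{ij})_{i,j=1}^q$ is the $q\times q$ matrix whose $i$th diagonal entry is $\sum_j a_{ij}$ and whose $(i,j)$ entry for $i\ne j$ is $-a_{ij}$. Edges are unordered pairs $(v_i,v_j)$ with $i\ne j$. For an edge set $\mathcal{E}$, $\mathrm{ver}\,\mathcal{E}\subset\mathcal{V}$ denotes the set of vertices incident to an edge, $\mathrm{ver}\,\mathcal{E}=\{v_i:(v_i,v_j)\in\mathcal{E}\}$. The graphs $\mathcal{M}=(\mathcal{V},\mathcal{E}_{\mathrm m})$ and $\mathcal{K}=(\mathcal{V},\mathcal{E}_{\mathrm k})$ are edge-isolated if $\mathrm{ver}\,\mathcal{E}_{\mathrm m}\cap\mathrm{ver}\,\mathcal{E}_{\mathrm k}=\emptyset$. For $A\in\mathbb{C}^{q\times q}$, $\lambda_i(A)$ denotes the $i$th eigenvalue of $A$ (counted with multiplicity) with respect to the ordering $\mathrm{Re}\,\lambda_1(A)\le\mathrm{Re}\,\lambda_2(A)\le\cdots\le\mathrm{Re}\,\lambda_q(A)$. The oscillators are said to synchronize if, for all initial conditions, the solutions satisfy $|x_i(t)-x_j(t)|\to 0$ as $t\to\infty$ for all pairs $(i,j)$. *)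

theory Defs
  imports
    Complex_Main
    "Jordan_Normal_Form.Char_Poly"
    "HOL-Computational_Algebra.Fundamental_Theorem_Algebra"
begin

(* Indices range over {0..<q}, as for the matrices of Jordan_Normal_Form;
   the vertex v_i is represented by its index i. *)

definition lap :: "nat \<Rightarrow> (nat \<Rightarrow> nat \<Rightarrow> real) \<Rightarrow> real mat" where
  "lap q a = mat q q (\<lambda>(i, j). if i = j then (\<Sum>l<q. a i l) else - a i j)"

definition edges :: "nat \<Rightarrow> (nat \<Rightarrow> nat \<Rightarrow> real) \<Rightarrow> nat set set" where
  "edges q a = {{i, j} | i j. i < q \<and> j < q \<and> i \<noteq> j \<and> a i j > 0}"

definition ver :: "nat set set \<Rightarrow> nat set" where
  "ver E = {i. \<exists>j. {i, j} \<in> E}"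

definition edge_isolated :: "nat set set \<Rightarrow> nat set set \<Rightarrow> bool" where
  "edge_isolated E F \<longleftrightarrow> ver E \<inter> ver F = {}"

(* The eigenvalues with algebraic multiplicity, by nondecreasing real part.
   The order among eigenvalues with equal real part is left open, so only
   Re (eig i A), with 1-based i, is determined by A. *)
definition eigenvalue_list :: "complex mat \<Rightarrow> complex list" where
  "eigenvalue_list A =
     (SOME es. mset es = proots (char_poly A) \<and> sorted (map Re es))"

definition eig :: "nat \<Rightarrow> complex mat \<Rightarrow> complex" where
  "eig i A = eigenvalue_list A ! (i - 1)"

lemma eigenvalue_list:
  shows mset_eigenvalue_list: "mset (eigenvalue_list A) = proots (char_poly A)"
    and sorted_eigenvalue_list: "sorted (map Re (eigenvalue_list A))"
proof -
  obtain xs where "mset xs = proots (char_poly A)"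
    using ex_mset by blast
  then have "\<exists>es. mset es = proots (char_poly A) \<and> sorted (map Re es)"
    by (intro exI[of _ "sort_key Re xs"]) simp
  from someI_ex[OF this]
  show "mset (eigenvalue_list A) = proots (char_poly A)"
    and "sorted (map Re (eigenvalue_list A))"
    unfolding eigenvalue_list_def by auto
qed

lemma length_eigenvalue_list:
  assumes "A \<in> carrier_mat n n"
  shows "length (eigenvalue_list A) = n"
  using degree_monic_char_poly[OF assms]
  by (metis mset_eigenvalue_list size_mset size_proots_complex)

(* x i t is the position of oscillator i at time t \<ge> 0; v and w are its
   velocity and acceleration (one-sided at t = 0). *)
definition oscillator_solution ::
  "nat \<Rightarrow> real \<Rightarrow> real \<Rightarrow> (nat \<Rightarrow> nat \<Rightarrow> real) \<Rightarrow> (nat \<Rightarrow> nat \<Rightarrow> real) \<Rightarrow>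
   (nat \<Rightarrow> nat \<Rightarrow> real) \<Rightarrow> (nat \<Rightarrow> real \<Rightarrow> real) \<Rightarrow> bool" where
  "oscillator_solution q m0 k0 m b k x \<longleftrightarrow>
     (\<exists>v w. \<forall>t\<ge>0. \<forall>i<q.
        (x i has_real_derivative v i t) (at t within {0..}) \<and>
        (v i has_real_derivative w i t) (at t within {0..}) \<and>
        m0 * w i t + k0 * x i t
          + (\<Sum>j<q. m i j * (w i t - w j t))
          + (\<Sum>j<q. b i j * (v i t - v j t))
          + (\<Sum>j<q. k i j * (x i t - x j t)) = 0)"

(* Quantifying over all solutions amounts to quantifying over all initial
   positions and velocities. *)
definition synchronize ::
  "nat \<Rightarrow> real \<Rightarrow> real \<Rightarrow> (nat \<Rightarrow> nat \<Rightarrow> real) \<Rightarrow> (nat \<Rightarrow> nat \<Rightarrow> real) \<Rightarrow>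
   (nat \<Rightarrow> nat \<Rightarrow> real) \<Rightarrow> bool" where
  "synchronize q m0 k0 m b k \<longleftrightarrow>
     (\<forall>x. oscillator_solution q m0 k0 m b k x \<longrightarrow>
        (\<forall>i<q. \<forall>j<q. ((\<lambda>t. \<bar>x i t - x j t\<bar>) \<longlongrightarrow> 0) at_top))"

end

theory Submission
  imports "HOL-Analysis.Derivative" "Jordan_Normal_Form.Schur_Decomposition" Defs
begin

text \<open>Write \<open>M\<close>, \<open>B\<close>, \<open>K\<close> for the three Laplacians. All of them are positive semidefinite and
annihilate the all-ones vector. Both sides of the equivalence fail for the same reason: the
existence of a nonzero vector \<open>z\<close> with entries summing to \<open>0\<close> and \<open>B z = 0\<close> (a
silent mode, one that the dampers do not see) that is in addition an eigenvector: of \<open>K - M\<close> on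
the spectral side, and of the pencil formed by \<open>k0 + K\<close> and \<open>m0 + M\<close> on the dynamical side.

On the spectral side, pairing \<open>(B + \<i>(K - M)) z = e z\<close> with \<open>z\<close> gives \<open>Re e\<close> as a quotient of
nonnegative quantities, so \<open>e\<close> is imaginary exactly if \<open>z\<close> is in the kernel of \<open>B\<close> and is an
eigenvector of the Hermitian matrix \<open>K - M\<close>. The eigenvalue \<open>0\<close> of the all-ones vector has to be
left out. Adding the all-ones matrix moves this single root of the characteristic polynomial from
\<open>0\<close> to \<open>q\<close> and leaves the others in place (\<open>char_poly_add_ones\<close>), so \<open>Re \<lambda>\<^sub>2 > 0\<close> says that
the whole spectrum of \<open>B + \<i>(K - M) + ones\<close> lies in the open right half-plane, and no algebraic
multiplicities have to be analysed. Hence \<open>Re \<lambda>\<^sub>2 > 0\<close> fails iff some silent mode is an eigenvector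
of \<open>K - M\<close> (\<open>interconnection_eigenvalue_iff\<close>).

On the dynamical side, a silent mode with \<open>k0 z + K z = \<mu> (m0 z + M z)\<close>, \<open>\<mu> > 0\<close>, oscillates
forever as \<open>cos (sqrt \<mu> t) z\<close> (\<open>not_synchronize_if_vibration\<close>). Conversely, the deviations from
the mean position obey the same equations and have mean zero, so that \<open>B\<close> may be replaced by
\<open>B + ones\<close>. If no vibrating silent mode exists, then all characteristic roots of the modified
system have negative real part, because an energy balance forces each root on or to the right of
the imaginary axis to come from such a mode (\<open>vibration_of_unstable_root\<close>); the deviations then
decay (\<open>second_order_decay\<close>).

It remains to match the two eigenvector conditions, and this is where edge-isolation enters:
it gives \<open>M K = K M = 0\<close>. If \<open>K z - \<mu> M z = \<sigma> z\<close> with \<open>\<mu> > 0\<close>, multiplying by \<open>M\<close> or by \<open>K\<close>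
and comparing signs shows that \<open>M z = 0\<close> when \<open>\<sigma> \<ge> 0\<close> and \<open>K z = 0\<close> when \<open>\<sigma> \<le> 0\<close>. One of the
two terms is thus absent and \<open>\<mu>\<close> can be changed freely by rescaling \<open>\<sigma>\<close>
(\<open>vibration_iff_eigenvector\<close>).\<close>

section \<open>Graph Laplacians as Hermitian forms\<close>

definition weights :: "nat \<Rightarrow> (nat \<Rightarrow> nat \<Rightarrow> real) \<Rightarrow> bool" where
  "weights q a \<longleftrightarrow> (\<forall>i<q. \<forall>j<q. a i j = a j i \<and> a i j \<ge> 0) \<and> (\<forall>i<q. a i i = 0)"

lemma weights_sym: "weights q a \<Longrightarrow> i < q \<Longrightarrow> j < q \<Longrightarrow> a i j = a j i"
  and weights_nonneg: "weights q a \<Longrightarrow> i < q \<Longrightarrow> j < q \<Longrightarrow> a i j \<ge> 0"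
  and weights_diag: "weights q a \<Longrightarrow> i < q \<Longrightarrow> a i i = 0"
  by (auto simp: weights_def)

text \<open>The action of the Laplacian of \<open>a\<close>, in the form in which it occurs in the equations of motion.
Values in an arbitrary real vector space let the same operator serve real trajectories and complex
eigenvectors.\<close>

definition coupling ::
  "nat \<Rightarrow> (nat \<Rightarrow> nat \<Rightarrow> real) \<Rightarrow> (nat \<Rightarrow> 'a :: real_vector) \<Rightarrow> nat \<Rightarrow> 'a" where
  "coupling q a z i = (\<Sum>j<q. a i j *\<^sub>R (z i - z j))"

text \<open>The quadratic form of the Laplacian; each edge is counted in both directions, whence the factor
one half.\<close>

definition dirichlet :: "nat \<Rightarrow> (nat \<Rightarrow> nat \<Rightarrow> real) \<Rightarrow> (nat \<Rightarrow> complex) \<Rightarrow> real" where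
  "dirichlet q a z = (\<Sum>i<q. \<Sum>j<q. a i j * (cmod (z i - z j))\<^sup>2) / 2"

lemma coupling_cong:
  "(\<And>i. i < q \<Longrightarrow> y i = z i) \<Longrightarrow> i < q \<Longrightarrow> coupling q a y i = coupling q a z i"
  unfolding coupling_def by (intro sum.cong) auto

lemma coupling_linear:
  "linear f \<Longrightarrow> f (coupling q a z i) = coupling q a (\<lambda>j. f (z j)) i"
  unfolding coupling_def by (simp add: linear_sum linear_scale linear_diff)

lemma coupling_const_diff: "coupling q a (\<lambda>j. z j - c) i = coupling q a z i"
  by (simp add: coupling_def)

lemma coupling_scaleR: "coupling q a (\<lambda>j. c *\<^sub>R z j) i = c *\<^sub>R coupling q a z i"
  by (simp add: coupling_def scaleR_sum_right algebra_simps)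

lemma sum_coupling:
  assumes "weights q a"
  shows "(\<Sum>i<q. coupling q a z i) = 0"
proof -
  have "(\<Sum>i<q. coupling q a z i)
      = (\<Sum>i<q. \<Sum>j<q. a i j *\<^sub>R z i) - (\<Sum>i<q. \<Sum>j<q. a i j *\<^sub>R z j)"
    by (simp add: coupling_def scaleR_diff_right sum_subtractf)
  also have "(\<Sum>i<q. \<Sum>j<q. a i j *\<^sub>R z j) = (\<Sum>j<q. \<Sum>i<q. a i j *\<^sub>R z j)"
    by (rule sum.swap)
  also have "\<dots> = (\<Sum>i<q. \<Sum>j<q. a i j *\<^sub>R z i)"
    by (intro sum.cong) (auto simp: weights_sym[OF assms])
  finally show ?thesis by simp
qed

text \<open>Swapping the summation indices and using the symmetry of \<open>a\<close> writes the pairing as the average of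
two double sums, in which the differences of \<open>y\<close> appear.\<close>

lemma coupling_pairing:
  fixes y z :: "nat \<Rightarrow> complex"
  assumes "weights q a"
  shows "(\<Sum>i<q. cnj (y i) * coupling q a z i)
    = (\<Sum>i<q. \<Sum>j<q. a i j *\<^sub>R (cnj (y i - y j) * (z i - z j))) / 2"
proof -
  let ?g = "\<lambda>i j. a i j *\<^sub>R (cnj (y i) * (z i - z j))"
  have 1: "(\<Sum>i<q. cnj (y i) * coupling q a z i) = (\<Sum>i<q. \<Sum>j<q. ?g i j)"
    by (simp add: coupling_def sum_distrib_left)
  have 2: "(\<Sum>i<q. \<Sum>j<q. ?g i j) = (\<Sum>i<q. \<Sum>j<q. - a i j *\<^sub>R (cnj (y j) * (z i - z j)))"
    by (subst sum.swap, intro sum.cong)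
       (auto simp: weights_sym[OF assms] algebra_simps)
  have "(\<Sum>i<q. \<Sum>j<q. a i j *\<^sub>R (cnj (y i - y j) * (z i - z j)))
      = (\<Sum>i<q. \<Sum>j<q. ?g i j) + (\<Sum>i<q. \<Sum>j<q. - a i j *\<^sub>R (cnj (y j) * (z i - z j)))"
    unfolding sum.distrib[symmetric]
    by (intro sum.cong refl) (simp add: algebra_simps)
  then show ?thesis using 1 2 by simp
qed

lemma coupling_pairing_self:
  assumes "weights q a"
  shows "(\<Sum>i<q. cnj (z i) * coupling q a z i) = of_real (dirichlet q a z)"
proof -
  have "cnj w * w = of_real ((cmod w)\<^sup>2)" for w
    by (metis complex_norm_square mult.commute)
  then show ?thesis
    unfolding coupling_pairing[OF assms] dirichlet_def
    by (simp add: scaleR_conv_of_real del: complex_cnj_diff of_real_power)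
qed

lemma coupling_selfadjoint:
  fixes y z :: "nat \<Rightarrow> complex"
  assumes "weights q a"
  shows "(\<Sum>i<q. cnj (y i) * coupling q a z i) = (\<Sum>i<q. cnj (coupling q a y i) * z i)"
proof -
  have "(\<Sum>i<q. cnj (coupling q a y i) * z i) = cnj (\<Sum>i<q. cnj (z i) * coupling q a y i)"
    by (simp add: mult.commute)
  also have "\<dots> = (\<Sum>i<q. cnj (y i) * coupling q a z i)"
    unfolding coupling_pairing[OF assms] by (simp add: scaleR_conv_of_real mult.commute)
  finally show ?thesis by simp
qed

lemma dirichlet_nonneg: "weights q a \<Longrightarrow> dirichlet q a z \<ge> 0"
  unfolding dirichlet_def by (intro divide_nonneg_nonneg sum_nonneg) (auto simp: weights_nonneg)

text \<open>The form is a sum of nonnegative edge terms: if it vanishes, then \<open>z\<close> is constant across each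
edge. This replaces an appeal to square roots of semidefinite matrices.\<close>

lemma coupling_eq_0_if_dirichlet_eq_0:
  assumes "weights q a" "dirichlet q a z = 0" "i < q"
  shows "coupling q a z i = 0"
proof -
  have nn: "a i j * (cmod (z i - z j))\<^sup>2 \<ge> 0" if "i < q" "j < q" for i j
    using that by (simp add: weights_nonneg[OF assms(1)])
  have "(\<Sum>i<q. \<Sum>j<q. a i j * (cmod (z i - z j))\<^sup>2) = 0"
    using assms(2) by (simp add: dirichlet_def)
  then have "(\<Sum>j<q. a i j * (cmod (z i - z j))\<^sup>2) = 0"
    using assms(3) nn by (subst (asm) sum_nonneg_eq_0_iff) (auto intro!: sum_nonneg)
  then have "a i j = 0 \<or> z i = z j" if "j < q" for j
    using that assms(3) nn by (subst (asm) sum_nonneg_eq_0_iff) auto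
  then show ?thesis
    unfolding coupling_def by (intro sum.neutral) auto
qed

lemma edge_isolated_sym: "edge_isolated E F \<Longrightarrow> edge_isolated F E"
  by (auto simp: edge_isolated_def)

text \<open>Edge-isolation in algebraic form: the product of the two Laplacians vanishes. If
\<open>a i j\<close> is positive, then neither \<open>i\<close> nor \<open>j\<close> lies on an edge of \<open>c\<close>, so the Laplacian of \<open>c\<close>
vanishes at both vertices and their difference does not contribute.\<close>

lemma coupling_coupling_isolated:
  assumes a: "weights q a" and c: "weights q c"
    and iso: "edge_isolated (edges q a) (edges q c)" and "i < q"
  shows "coupling q a (coupling q c z) i = 0"
proof -
  have ver: "i \<in> ver (edges q d)" if "weights q d" "i < q" "j < q" "d i j \<noteq> 0" for d i j
  proof -
    have "d i j > 0" "i \<noteq> j"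
      using weights_nonneg[OF that(1-3)] weights_diag[OF that(1,2)] that(4) by auto
    then show ?thesis
      using that unfolding ver_def edges_def by blast
  qed
  have "a i j = 0 \<or> coupling q c z i = coupling q c z j" if "j < q" for j
  proof (cases "a i j = 0")
    case False
    then have "i \<in> ver (edges q a)" "j \<in> ver (edges q a)"
      using ver[OF a \<open>i < q\<close> that] ver[OF a that \<open>i < q\<close>] weights_sym[OF a \<open>i < q\<close> that] by auto
    then have "i \<notin> ver (edges q c)" "j \<notin> ver (edges q c)"
      using iso by (auto simp: edge_isolated_def)
    then have "c i l = 0" "c j l = 0" if "l < q" for l
      using ver[OF c] that \<open>i < q\<close> \<open>j < q\<close> by blast+
    then show ?thesis by (simp add: coupling_def)
  qed auto
  then show ?thesis
    unfolding coupling_def[of q a] by (intro sum.neutral) auto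
qed

lemma sum_cnj_mult_self:
  fixes z :: "nat \<Rightarrow> complex"
  shows "(\<Sum>i<q. cnj (z i) * z i) = of_real (\<Sum>i<q. (cmod (z i))\<^sup>2)"
  unfolding of_real_sum by (intro sum.cong refl) (metis complex_norm_square mult.commute)

lemma sum_norm_square_pos:
  fixes z :: "nat \<Rightarrow> complex"
  assumes "i < q" "z i \<noteq> 0"
  shows "(\<Sum>i<q. (cmod (z i))\<^sup>2) > 0"
  using assms by (intro sum_pos2[of _ i]) auto

lemma sum_cnj_mult_self_eq_0:
  fixes z :: "nat \<Rightarrow> complex"
  assumes "(\<Sum>i<q. cnj (z i) * z i) = of_real r" "r \<le> 0" "i < q"
  shows "z i = 0"
  using sum_norm_square_pos[of i q z] assms unfolding sum_cnj_mult_self of_real_eq_iff by force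

text \<open>Displacements along which no damper is moved. The condition on the sum excludes
the common motion of all oscillators.\<close>

definition silent_mode ::
  "nat \<Rightarrow> (nat \<Rightarrow> nat \<Rightarrow> real) \<Rightarrow> (nat \<Rightarrow> complex) \<Rightarrow> bool" where
  "silent_mode q b z \<longleftrightarrow>
     (\<exists>i<q. z i \<noteq> 0) \<and> (\<Sum>i<q. z i) = 0 \<and> (\<forall>i<q. coupling q b z i = 0)"

text \<open>The Hermitian form of \<open>B + ones\<close>.\<close>

definition damping_form :: "nat \<Rightarrow> (nat \<Rightarrow> nat \<Rightarrow> real) \<Rightarrow> (nat \<Rightarrow> complex) \<Rightarrow> real" where
  "damping_form q b z = dirichlet q b z + (cmod (\<Sum>i<q. z i))\<^sup>2"

lemma damping_form_pairing:
  assumes "weights q b"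
  shows "(\<Sum>i<q. cnj (z i) * (coupling q b z i + (\<Sum>j<q. z j))) = of_real (damping_form q b z)"
proof -
  have "(\<Sum>i<q. cnj (z i) * (\<Sum>j<q. z j)) = cnj (\<Sum>i<q. z i) * (\<Sum>j<q. z j)"
    by (simp add: sum_distrib_right)
  also have "\<dots> = of_real ((cmod (\<Sum>i<q. z i))\<^sup>2)"
    by (metis complex_norm_square mult.commute)
  finally show ?thesis
    by (simp add: damping_form_def distrib_left sum.distrib coupling_pairing_self[OF assms])
qed

lemma damping_form_nonneg: "weights q b \<Longrightarrow> damping_form q b z \<ge> 0"
  by (simp add: damping_form_def dirichlet_nonneg)

lemma silent_mode_if_damping_form_eq_0:
  assumes b: "weights q b" and z: "damping_form q b z = 0" "i < q" "z i \<noteq> 0"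
  shows "silent_mode q b z"
proof -
  have "dirichlet q b z = 0" "(\<Sum>i<q. z i) = 0"
    using z(1) dirichlet_nonneg[OF b, of z] unfolding damping_form_def
    by (simp_all add: add_nonneg_eq_0_iff)
  then show ?thesis
    using z coupling_eq_0_if_dirichlet_eq_0[OF b] by (auto simp: silent_mode_def)
qed

section \<open>Mass and spring couplings without a common vertex\<close>

text \<open>Applying the Laplacian \<open>A\<close> of \<open>a\<close> to the eigenvector equation kills the other Laplacian and leaves
\<open>\<alpha> A (A z) = \<sigma> A z\<close>. Pairing with \<open>z\<close> gives \<open>\<alpha> |A z|^2 = \<sigma> \<langle>z, A z\<rangle>\<close>, where the signs of
the two sides are opposite.\<close>

lemma coupling_eq_0_of_signed_eigenvector:
  fixes z :: "nat \<Rightarrow> complex"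
  assumes a: "weights q a" and c: "weights q c"
    and iso: "edge_isolated (edges q a) (edges q c)"
    and eq: "\<And>i. i < q \<Longrightarrow>
      \<alpha> *\<^sub>R coupling q a z i + \<gamma> *\<^sub>R coupling q c z i = \<sigma> *\<^sub>R z i"
    and sgn: "\<alpha> * \<sigma> \<le> 0" "\<alpha> \<noteq> 0" and i: "i < q"
  shows "coupling q a z i = 0"
proof -
  let ?a = "coupling q a z"
  have aa: "\<alpha> *\<^sub>R coupling q a ?a i = \<sigma> *\<^sub>R ?a i" if "i < q" for i
  proof -
    have "\<sigma> *\<^sub>R ?a i = coupling q a (\<lambda>j. \<sigma> *\<^sub>R z j) i"
      by (simp add: coupling_scaleR)
    also have "\<dots> = coupling q a (\<lambda>j. \<alpha> *\<^sub>R ?a j + \<gamma> *\<^sub>R coupling q c z j) i"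
      using that eq by (intro coupling_cong) auto
    also have "\<dots> = coupling q a (\<lambda>j. \<alpha> *\<^sub>R ?a j) i + coupling q a (\<lambda>j. \<gamma> *\<^sub>R coupling q c z j) i"
      by (simp add: coupling_def[of q a] algebra_simps sum.distrib sum_subtractf)
    finally show ?thesis
      by (simp add: coupling_scaleR coupling_coupling_isolated[OF a c iso that])
  qed
  have "\<alpha> *\<^sub>R (\<Sum>i<q. cnj (?a i) * ?a i) = \<alpha> *\<^sub>R (\<Sum>i<q. cnj (z i) * coupling q a ?a i)"
    by (subst coupling_selfadjoint[OF a, symmetric]) simp
  also have "\<dots> = \<sigma> *\<^sub>R (\<Sum>i<q. cnj (z i) * ?a i)"
    unfolding scaleR_sum_right mult_scaleR_right[symmetric]
    by (intro sum.cong refl) (simp add: aa)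
  also have "\<dots> = of_real (\<sigma> * dirichlet q a z)"
    by (simp add: coupling_pairing_self[OF a] scaleR_conv_of_real)
  finally have "(\<Sum>i<q. cnj (?a i) * ?a i) = of_real (\<sigma> * dirichlet q a z / \<alpha>)"
    using sgn(2) by (simp add: scaleR_conv_of_real field_simps)
  moreover have "\<sigma> * dirichlet q a z / \<alpha> = (\<alpha> * \<sigma>) * dirichlet q a z / (\<alpha> * \<alpha>)"
    using sgn(2) by simp
  moreover have "(\<alpha> * \<sigma>) * dirichlet q a z / (\<alpha> * \<alpha>) \<le> 0"
    by (rule divide_nonpos_nonneg[OF mult_nonpos_nonneg[OF sgn(1) dirichlet_nonneg[OF a]]]) simp
  ultimately show ?thesis
    using sum_cnj_mult_self_eq_0[OF _ _ i] by metis
qed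

text \<open>Both conditions have the form \<open>K z - \<mu> M z = \<sigma> z\<close> with \<open>\<mu> > 0\<close>: on the right \<open>\<mu> = 1\<close> and \<open>\<sigma> = \<omega>\<close>,
on the left \<open>\<sigma> = \<mu> m0 - k0\<close>. Since one of \<open>M z\<close>, \<open>K z\<close> vanishes according to the sign of \<open>\<sigma>\<close>,
each form can be turned into the other.\<close>

lemma vibration_iff_eigenvector:
  fixes z :: "nat \<Rightarrow> complex"
  assumes m: "weights q m" and k: "weights q k"
    and iso: "edge_isolated (edges q m) (edges q k)"
    and pos: "m0 > 0" "k0 > 0"
  shows "(\<exists>\<mu>>0. \<forall>i<q. k0 *\<^sub>R z i + coupling q k z i = \<mu> *\<^sub>R (m0 *\<^sub>R z i + coupling q m z i))
    \<longleftrightarrow> (\<exists>\<omega>. \<forall>i<q. coupling q k z i - coupling q m z i = \<omega> *\<^sub>R z i)"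
    (is "?vib \<longleftrightarrow> ?eig")
proof -
  have split: "(\<sigma> \<ge> 0 \<longrightarrow> (\<forall>i<q. coupling q m z i = 0)) \<and>
      (\<sigma> \<le> 0 \<longrightarrow> (\<forall>i<q. coupling q k z i = 0))"
    if eq: "\<forall>i<q. coupling q k z i - \<mu> *\<^sub>R coupling q m z i = \<sigma> *\<^sub>R z i" and "\<mu> > 0" for \<mu> \<sigma>
  proof (intro conjI impI allI)
    fix i assume "\<sigma> \<ge> 0" "i < q"
    then show "coupling q m z i = 0"
      using eq \<open>\<mu> > 0\<close>
      by (intro coupling_eq_0_of_signed_eigenvector[OF m k iso, where \<alpha> = "-\<mu>" and \<gamma> = 1 and \<sigma> = \<sigma>])
         auto
  next
    fix i assume "\<sigma> \<le> 0" "i < q"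
    then show "coupling q k z i = 0"
      using eq 
      by (intro coupling_eq_0_of_signed_eigenvector[OF k m edge_isolated_sym[OF iso],
              where \<alpha> = 1 and \<gamma> = "-\<mu>" and \<sigma> = \<sigma>]) auto
  qed
  show ?thesis
  proof
    assume ?vib
    then obtain \<mu> where mu: "\<mu> > 0"
      and eq: "\<forall>i<q. k0 *\<^sub>R z i + coupling q k z i = \<mu> *\<^sub>R (m0 *\<^sub>R z i + coupling q m z i)"
      by auto
    define \<sigma> where "\<sigma> = \<mu> * m0 - k0"
    have eq': "\<forall>i<q. coupling q k z i - \<mu> *\<^sub>R coupling q m z i = \<sigma> *\<^sub>R z i"
      using eq by (auto simp: \<sigma>_def algebra_simps)
    show ?eig
    proof (cases "\<sigma> \<ge> 0")
      case True
      then show ?thesis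
        using split[OF eq' mu] eq' by (intro exI[of _ \<sigma>]) auto
    next
      case False
      then have K0: "coupling q k z i = 0" if "i < q" for i
        using split[OF eq' mu] that by auto
      \<comment> \<open>Only the masses act, so dividing by \<open>\<mu>\<close> normalizes their coefficient to one.\<close>
      have "coupling q k z i - coupling q m z i = (\<sigma> / \<mu>) *\<^sub>R z i" if "i < q" for i
      proof -
        have "(\<sigma> / \<mu>) *\<^sub>R z i = (1 / \<mu>) *\<^sub>R (\<sigma> *\<^sub>R z i)" by simp
        also have "\<dots> = (1 / \<mu>) *\<^sub>R (- (\<mu> *\<^sub>R coupling q m z i))"
          using eq' that K0 by (metis diff_0)
        finally show ?thesis using mu K0[OF that] by simp
      qed
      then show ?thesis by blast
    qed
  next
    assume ?eig
    then obtain \<omega> where eq: "\<forall>i<q. coupling q k z i - coupling q m z i = \<omega> *\<^sub>R z i" by auto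
    then have eq': "\<forall>i<q. coupling q k z i - 1 *\<^sub>R coupling q m z i = \<omega> *\<^sub>R z i" by simp
    show ?vib
    proof (cases "\<omega> \<ge> 0")
      case True
      then show ?thesis
        using split[OF eq'] eq pos
        \<comment> \<open>Here \<open>M z = 0\<close>, and \<open>\<mu>\<close> is determined by \<open>\<mu> m0 - k0 = \<omega>\<close>.\<close>
        by (intro exI[of _ "(\<omega> + k0) / m0"]) (auto simp: scaleR_left_distrib add_pos_nonneg)
    next
      case False
      then have K0: "coupling q k z i = 0" if "i < q" for i
        using split[OF eq'] that by auto
      have M: "coupling q m z i = (- \<omega>) *\<^sub>R z i" if "i < q" for i
        using eq K0 that by (metis diff_0 minus_minus scaleR_minus_left)
      \<comment> \<open>Here \<open>K z = 0\<close> and \<open>M z = - \<omega> z\<close>, so \<open>k0 = \<mu> (m0 - \<omega>)\<close> determines \<open>\<mu>\<close>.\<close>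
      have "m0 - \<omega> > 0" using pos False by simp
      then show ?thesis
        using pos K0 M
        by (intro exI[of _ "k0 / (m0 - \<omega>)"])
           (auto simp: scaleR_diff_left[symmetric] scaleR_left_diff_distrib[symmetric])
    qed
  qed
qed

section \<open>Deflating the eigenvalue of the all-ones vector\<close>

lemma mult_mat_vec_index_sum:
  "A \<in> carrier_mat n m \<Longrightarrow> v \<in> carrier_vec m \<Longrightarrow> i < n \<Longrightarrow>
    (A *\<^sub>v v) $ i = (\<Sum>j<m. A $$ (i, j) * v $ j)"
  by (auto simp: scalar_prod_def lessThan_atLeast0 intro!: sum.cong)

definition ones :: "nat \<Rightarrow> complex mat" where
  "ones q = mat q q (\<lambda>_. 1)"

lemma ones_carrier [simp]: "ones q \<in> carrier_mat q q"
  by (simp add: ones_def)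

lemma dim_ones [simp]: "dim_row (ones q) = q" "dim_col (ones q) = q"
  by (simp_all add: ones_def)

lemma ones_mult_vec: "v \<in> carrier_vec q \<Longrightarrow> i < q \<Longrightarrow> (ones q *\<^sub>v v) $ i = (\<Sum>j<q. v $ j)"
  by (auto simp: ones_def scalar_prod_def mult_mat_vec_def lessThan_atLeast0 intro!: sum.cong)

text \<open>Border \<open>X\<close> by a row and a column of ones. Subtracting the new first row from the others produces
the Schur complement \<open>X - ones\<close>. Multiplying the first column by \<open>x\<close> and subtracting the remaining
ones cancels the bordering column, because the rows of \<open>X\<close> sum to \<open>x\<close>, and leaves \<open>x - q\<close> in the
corner. Comparing determinants avoids a division by \<open>x\<close>.\<close>

lemma det_minus_ones:
  fixes X :: "complex mat"
  assumes X: "X \<in> carrier_mat q q"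
    and row_sums: "\<And>i. i < q \<Longrightarrow> (\<Sum>j<q. X $$ (i, j)) = x"
  shows "x * det (X - ones q) = (x - of_nat q) * det X"
proof -
  define c r where "c = mat q 1 (\<lambda>_. 1 :: complex)" and "r = mat 1 q (\<lambda>_. 1 :: complex)"
  define s where "s y = mat 1 1 (\<lambda>_. y :: complex)" for y
  have car: "c \<in> carrier_mat q 1" "r \<in> carrier_mat 1 q" "s y \<in> carrier_mat 1 1" for y
    by (auto simp: c_def r_def s_def)
  have det_s: "det (s y) = y" for y
    by (subst det_single) (auto simp: s_def)
  let ?N = "four_block_mat (s 1) r c X"
  let ?L = "four_block_mat (s 1) (0\<^sub>m 1 q) (- c) (1\<^sub>m q)"
  let ?R = "four_block_mat (s x) (0\<^sub>m 1 q) (- c) (1\<^sub>m q)"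
  have N: "?N \<in> carrier_mat (1 + q) (1 + q)"
    using car X by (intro four_block_carrier_mat) auto
  have LR: "?L \<in> carrier_mat (1 + q) (1 + q)" "?R \<in> carrier_mat (1 + q) (1 + q)"
    by (rule four_block_carrier_mat[OF car(3) one_carrier_mat])+
  have X1: "X * - c = - (x \<cdot>\<^sub>m c)"
  proof (rule eq_matI)
    fix i j assume "i < dim_row (- (x \<cdot>\<^sub>m c))" "j < dim_col (- (x \<cdot>\<^sub>m c))"
    then show "(X * - c) $$ (i, j) = (- (x \<cdot>\<^sub>m c)) $$ (i, j)"
      using X row_sums[of i]
      by (auto simp: c_def scalar_prod_def sum_negf lessThan_atLeast0)
  qed (use X in \<open>auto simp: c_def\<close>)
  have left: "?L * ?N = four_block_mat (s 1) r (0\<^sub>m q 1) (X - ones q)"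
    using car X
    by (subst mult_four_block_mat[of _ 1 1 _ q _ q])
       (auto simp: s_def r_def c_def ones_def scalar_prod_def intro!: cong_four_block_mat eq_matI)
  have right: "?N * ?R = four_block_mat (s (x - of_nat q)) r (0\<^sub>m q 1) X"
    using car X
    by (subst mult_four_block_mat[of _ 1 1 _ q _ q])
       (auto simp: X1 s_def r_def c_def scalar_prod_def row_sums[unfolded lessThan_atLeast0]
         intro!: cong_four_block_mat eq_matI)
  have X': "X - ones q \<in> carrier_mat q q" and c': "- c \<in> carrier_mat q 1"
    using car by (simp_all add: minus_carrier_mat)
  have det_LR: "det ?L = 1" "det ?R = x"
    by (simp_all only: det_four_block_mat_upper_right_zero[OF car(3) refl c' one_carrier_mat]
        det_s det_one mult_1_right)
  have "x * det (X - ones q) = det (?L * ?N) * det ?R"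
    unfolding left det_LR det_four_block_mat_lower_left_zero[OF car(3) car(2) refl X'] det_s
    by simp
  also have "\<dots> = det ?L * det (?N * ?R)"
    unfolding det_mult[OF LR(1) N] det_mult[OF N LR(2)] by simp
  also have "\<dots> = (x - of_nat q) * det X"
    unfolding right det_LR det_four_block_mat_lower_left_zero[OF car(3) car(2) refl X] det_s
    by simp
  finally show ?thesis .
qed

text \<open>One root \<open>0\<close>, that of the all-ones vector, is replaced by \<open>q\<close>, and all other roots stay, with
their multiplicities. The identity holds pointwise by the preceding lemma, applied to \<open>x - A\<close>,
whose rows sum to \<open>x\<close>.\<close>

lemma char_poly_add_ones:
  assumes A: "A \<in> carrier_mat q q"
    and kernel: "\<And>i. i < q \<Longrightarrow> (\<Sum>j<q. A $$ (i, j)) = 0"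
  shows "[:0, 1:] * char_poly (A + ones q) = [:- of_nat q, 1:] * char_poly A"
proof (rule poly_eq_poly_eq_iff[THEN iffD1], rule ext)
  fix x :: complex
  let ?X = "- char_matrix A x"
  have X: "?X \<in> carrier_mat q q" using A by simp
  have "- char_matrix (A + ones q) x = ?X - ones q"
    using A by (intro eq_matI) (auto simp: char_matrix_def ones_def)
  moreover have "(\<Sum>j<q. ?X $$ (i, j)) = x" if i: "i < q" for i
  proof -
    have "(\<Sum>j<q. ?X $$ (i, j)) = (\<Sum>j<q. (if i = j then x else 0) - A $$ (i, j))"
      using A i by (intro sum.cong) (auto simp: char_matrix_def)
    also have "\<dots> = x"
      using i by (simp add: sum_subtractf kernel)
    finally show ?thesis .
  qed
  ultimately show "poly ([:0, 1:] * char_poly (A + ones q)) x =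
      poly ([:- of_nat q, 1:] * char_poly A) x"
    using det_minus_ones[OF X] A by (simp add: char_poly_matrix[of _ q] algebra_simps)
qed

text \<open>As multisets, the roots for \<open>A\<close> are \<open>0\<close> together with some \<open>R\<close>, and those for \<open>A + ones\<close> are
\<open>q\<close> together with the same \<open>R\<close>. So the second eigenvalue in the ordering has positive real part
iff all of \<open>R\<close> does.\<close>

lemma Re_eig_2_pos_iff:
  assumes A: "A \<in> carrier_mat q q" and q: "q \<ge> 2"
    and kernel: "\<And>i. i < q \<Longrightarrow> (\<Sum>j<q. A $$ (i, j)) = 0"
  shows "Re (eig 2 A) > 0 \<longleftrightarrow> (\<forall>e. eigenvalue (A + ones q) e \<longrightarrow> Re e > 0)"
proof -
  let ?A' = "A + ones q"
  let ?es = "eigenvalue_list A"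
  have A': "?A' \<in> carrier_mat q q" using A by simp
  have nz: "char_poly A \<noteq> 0" "char_poly ?A' \<noteq> 0"
    using degree_monic_char_poly[OF A] degree_monic_char_poly[OF A'] q by auto
  have "proots ([:0, 1:] * char_poly ?A') = proots ([:- of_nat q, 1:] * char_poly A)"
    by (simp only: char_poly_add_ones[OF A kernel])
  then have "add_mset 0 (proots (char_poly ?A')) = add_mset (of_nat q) (mset ?es)"
    using nz proots_linear_factor[of 0] by (simp add: proots_mult mset_eigenvalue_list del: mult_pCons_left)
  then obtain R where R: "mset ?es = add_mset 0 R" "proots (char_poly ?A') = add_mset (of_nat q) R"
    using q by (auto simp: add_eq_conv_ex)
  have ev: "eigenvalue ?A' e \<longleftrightarrow> e = of_nat q \<or> e \<in># R" for e
    using nz set_count_proots[of "char_poly ?A'"]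
    by (auto simp: eigenvalue_root_char_poly[OF A'] R(2) dest: arg_cong[of _ _ set_mset])
  have len: "length ?es = q" by (rule length_eigenvalue_list[OF A])
  then obtain e0 e1 es where es: "?es = e0 # e1 # es"
    using q by (metis Suc_le_length_iff numeral_2_eq_2)
  have sorted: "Re e0 \<le> Re e1" "\<forall>e\<in>set es. Re e1 \<le> Re e"
    using sorted_eigenvalue_list[of A] es by auto
  have eig2: "eig 2 A = e1" by (simp add: eig_def es)
  have ms: "add_mset e0 (add_mset e1 (mset es)) = add_mset 0 R"
    using R(1) es by simp
  show ?thesis
  proof
    assume pos: "Re (eig 2 A) > 0"
    have "0 \<in># add_mset e0 (add_mset e1 (mset es))" unfolding ms by simp
    \<comment> \<open>All entries after the first have positive real part, so the root \<open>0\<close> can only be the first one.\<close>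
    then have "e0 = 0" using pos sorted eig2 by force
    then have "R = add_mset e1 (mset es)" using ms by simp
    then show "\<forall>e. eigenvalue ?A' e \<longrightarrow> Re e > 0"
      using pos sorted eig2 q ev by force
  next
    assume ev_pos: "\<forall>e. eigenvalue ?A' e \<longrightarrow> Re e > 0"
    show "Re (eig 2 A) > 0"
    proof (rule ccontr)
      assume "\<not> Re (eig 2 A) > 0"
      then have "Re e0 \<le> 0" "Re e1 \<le> 0" using sorted eig2 by auto
      moreover have "e0 \<in># R \<or> e1 \<in># R" 
        using ms by (metis add_mset_add_mset_same_iff add_mset_commute insert_noteq_member union_single_eq_member)
      ultimately show False using ev ev_pos by force
    qed
  qed
qed

section \<open>The spectrum of the interconnection matrix\<close>

abbreviation complex_lap :: "nat \<Rightarrow> (nat \<Rightarrow> nat \<Rightarrow> real) \<Rightarrow> complex mat" where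
  "complex_lap q a \<equiv> map_mat complex_of_real (lap q a)"

lemma lap_carrier [simp]: "lap q a \<in> carrier_mat q q"
  by (simp add: lap_def)

lemma complex_lap_sum:
  assumes a: "weights q a" and i: "i < q"
  shows "(\<Sum>j<q. complex_lap q a $$ (i, j) * z j) = coupling q a z i"
proof -
  have "(\<Sum>j<q. complex_lap q a $$ (i, j) * z j)
      = (\<Sum>j<q. (if i = j then of_real (\<Sum>l<q. a i l) * z i else 0) - of_real (a i j) * z j)"
    using i weights_diag[OF a i] by (intro sum.cong) (auto simp: lap_def)
  also have "\<dots> = (\<Sum>j<q. of_real (a i j) * z i) - (\<Sum>j<q. of_real (a i j) * z j)"
    using i by (simp add: sum_subtractf sum_distrib_right)
  also have "\<dots> = coupling q a z i"
    by (simp add: coupling_def scaleR_conv_of_real right_diff_distrib sum_subtractf)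
  finally show ?thesis .
qed

lemma complex_lap_mult_vec:
  assumes "weights q a" "i < q" "v \<in> carrier_vec q"
  shows "(complex_lap q a *\<^sub>v v) $ i = coupling q a (($) v) i"
  using assms by (simp add: mult_mat_vec_index_sum[of _ q q] complex_lap_sum del: index_mult_mat_vec)

definition interconnection ::
  "nat \<Rightarrow> (nat \<Rightarrow> nat \<Rightarrow> real) \<Rightarrow> (nat \<Rightarrow> nat \<Rightarrow> real) \<Rightarrow> (nat \<Rightarrow> nat \<Rightarrow> real) \<Rightarrow> complex mat" where
  "interconnection q m b k = complex_lap q b + \<i> \<cdot>\<^sub>m map_mat complex_of_real (lap q k - lap q m)"

lemma interconnection_carrier: "interconnection q m b k \<in> carrier_mat q q"
  by (simp add: interconnection_def minus_carrier_mat)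

lemma interconnection_sum:
  assumes w: "weights q m" "weights q b" "weights q k" and i: "i < q"
  shows "(\<Sum>j<q. interconnection q m b k $$ (i, j) * z j)
    = coupling q b z i + \<i> * (coupling q k z i - coupling q m z i)"
proof -
  have "(\<Sum>j<q. interconnection q m b k $$ (i, j) * z j) = (\<Sum>j<q. complex_lap q b $$ (i, j) * z j
      + \<i> * (complex_lap q k $$ (i, j) * z j - complex_lap q m $$ (i, j) * z j))"
    using i by (intro sum.cong) (auto simp: interconnection_def lap_def algebra_simps)
  then show ?thesis
    by (simp only: sum.distrib sum_subtractf sum_distrib_left[symmetric] complex_lap_sum[OF _ i] w)
qed

text \<open>Pairing an eigenvector with itself, the real part of the eigenvalue times \<open>|z|^2\<close> equals the
damping form, because the contribution of \<open>\<i>(K - M)\<close> is imaginary. A nonpositive real part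
therefore forces the damping form to vanish.\<close>

lemma interconnection_eigenvalue_iff:
  assumes w: "weights q m" "weights q b" "weights q k"
  shows "(\<exists>e. eigenvalue (interconnection q m b k + ones q) e \<and> Re e \<le> 0) \<longleftrightarrow>
    (\<exists>z. silent_mode q b z \<and>
      (\<exists>\<omega>. \<forall>i<q. coupling q k z i - coupling q m z i = \<omega> *\<^sub>R z i))"
    (is "?L \<longleftrightarrow> ?R")
proof -
  let ?A = "interconnection q m b k + ones q"
  have A: "?A \<in> carrier_mat q q" by (simp add: interconnection_carrier)
  have A_mult: "(?A *\<^sub>v v) $ i = coupling q b (($) v) i
      + \<i> * (coupling q k (($) v) i - coupling q m (($) v) i) + (\<Sum>j<q. v $ j)"
    if "v \<in> carrier_vec q" "i < q" for v i
  proof -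
    have "(?A *\<^sub>v v) $ i = (\<Sum>j<q. interconnection q m b k $$ (i, j) * v $ j + v $ j)"
      unfolding mult_mat_vec_index_sum[OF A that]
      using that interconnection_carrier[of q m b k]
      by (intro sum.cong) (auto simp: ones_def algebra_simps)
    then show ?thesis
      by (simp only: sum.distrib interconnection_sum[OF w that(2)])
  qed
  show ?thesis
  proof
    assume ?L
    then obtain e v where v: "v \<in> carrier_vec q" "v \<noteq> 0\<^sub>v q" "?A *\<^sub>v v = e \<cdot>\<^sub>v v" and e: "Re e \<le> 0"
      unfolding eigenvalue_def eigenvector_def carrier_matD(1)[OF A] by blast
    define z where "z = ($) v"
    obtain i where i: "i < q" "z i \<noteq> 0"
      using v(1,2) by (auto simp: z_def vec_eq_iff)
    have eq: "(coupling q b z i + (\<Sum>j<q. z j)) + \<i> * (coupling q k z i - coupling q m z i) = e * z i"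
      if "i < q" for i
      using A_mult[OF v(1) that] v(1) that unfolding v(3) by (simp add: z_def)
    have "e * of_real (\<Sum>i<q. (cmod (z i))\<^sup>2) = (\<Sum>i<q. cnj (z i) * (e * z i))"
      unfolding sum_cnj_mult_self[symmetric] by (simp add: sum_distrib_left algebra_simps)
    also have "\<dots> = (\<Sum>i<q. cnj (z i) * (coupling q b z i + (\<Sum>j<q. z j)) +
        \<i> * (cnj (z i) * coupling q k z i - cnj (z i) * coupling q m z i))"
      by (intro sum.cong refl) (simp add: eq[symmetric] algebra_simps)
    also have "\<dots> = of_real (damping_form q b z) + \<i> * of_real (dirichlet q k z - dirichlet q m z)"
      by (simp only: sum.distrib sum_subtractf sum_distrib_left[symmetric] of_real_diff
          damping_form_pairing[OF w(2)] coupling_pairing_self w)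
    finally have "Re (e * of_real (\<Sum>i<q. (cmod (z i))\<^sup>2))
        = Re (of_real (damping_form q b z) + \<i> * of_real (dirichlet q k z - dirichlet q m z))"
      by (rule arg_cong)
    then have re: "Re e * (\<Sum>i<q. (cmod (z i))\<^sup>2) = damping_form q b z"
      by simp
    have N: "(\<Sum>i<q. (cmod (z i))\<^sup>2) > 0" by (rule sum_norm_square_pos[of i]) (fact i)+
    have "Re e * (\<Sum>i<q. (cmod (z i))\<^sup>2) \<le> 0"
      using e N by (simp add: mult_nonpos_nonneg)
    then have damp0: "damping_form q b z = 0"
      using re damping_form_nonneg[OF w(2), of z] by linarith
    then have e_im: "e = \<i> * of_real (Im e)"
      using re N by (simp add: complex_eq_iff)
    have silent: "silent_mode q b z"
      using silent_mode_if_damping_form_eq_0[OF w(2) damp0 i] .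
    have "coupling q k z i - coupling q m z i = Im e *\<^sub>R z i" if "i < q" for i
    proof -
      have "\<i> * (coupling q k z i - coupling q m z i) = \<i> * (Im e *\<^sub>R z i)"
        using eq[OF that] silent that e_im
        by (simp add: silent_mode_def scaleR_conv_of_real mult.assoc)
      then show ?thesis by (simp only: mult_cancel_left) simp
    qed
    with silent show ?R by blast
  next
    assume ?R
    then obtain z \<omega> where silent: "silent_mode q b z"
      and eq: "\<And>i. i < q \<Longrightarrow> coupling q k z i - coupling q m z i = \<omega> *\<^sub>R z i" by blast
    define v where "v = vec q z"
    have v: "v \<in> carrier_vec q" by (simp add: v_def)
    have C: "coupling q a (($) v) i = coupling q a z i" if "i < q" for a i
      using that by (intro coupling_cong) (auto simp: v_def)
    have "v \<noteq> 0\<^sub>v q"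
      using silent by (auto simp: silent_mode_def v_def vec_eq_iff)
    moreover have "?A *\<^sub>v v = (\<i> * of_real \<omega>) \<cdot>\<^sub>v v"
    proof (rule eq_vecI)
      fix i assume "i < dim_vec ((\<i> * of_real \<omega>) \<cdot>\<^sub>v v)"
      then have i: "i < q" by (simp add: v_def)
      have "(\<Sum>j<q. v $ j) = 0"
        using silent by (simp add: v_def silent_mode_def)
      then show "(?A *\<^sub>v v) $ i = ((\<i> * of_real \<omega>) \<cdot>\<^sub>v v) $ i"
        unfolding A_mult[OF v i] C[OF i] eq[OF i]
        using silent i by (simp add: silent_mode_def v_def scaleR_conv_of_real)
    qed (simp add: v_def ones_def)
    ultimately have "eigenvalue ?A (\<i> * of_real \<omega>)"
      unfolding eigenvalue_def eigenvector_def carrier_matD(1)[OF A] using v by blast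
    then show ?L by (intro exI[of _ "\<i> * of_real \<omega>"]) simp
  qed
qed

section \<open>Decay of linear systems with spectrum in the open left half-plane\<close>

text \<open>The integrating factor \<open>exp (- e t)\<close> turns the equation into \<open>g' = exp (- e t) f\<close>. Once \<open>|f| < \<delta>\<close>,
the growth of \<open>g\<close> is dominated by a multiple of \<open>exp (a t)\<close> with \<open>a = - Re e\<close>, and undoing the factor
leaves a decaying term plus \<open>\<delta> / a\<close>.\<close>

lemma scalar_ode_decay:
  fixes u f :: "real \<Rightarrow> complex"
  assumes ode: "\<And>t. t \<ge> 0 \<Longrightarrow> (u has_vector_derivative e * u t + f t) (at t within {0..})"
    and f: "(f \<longlongrightarrow> 0) at_top" and e: "Re e < 0"
  shows "(u \<longlongrightarrow> 0) at_top"
proof (rule tendstoI)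
  fix \<epsilon> :: real assume "\<epsilon> > 0"
  define a where "a = - Re e"
  have a: "a > 0" using e by (simp add: a_def)
  define \<delta> where "\<delta> = \<epsilon> * a / 2"
  have d: "\<delta> > 0" using a \<open>\<epsilon> > 0\<close> by (simp add: \<delta>_def)
  from tendstoD[OF f d] obtain T0 where T0: "\<And>t. t \<ge> T0 \<Longrightarrow> norm (f t) < \<delta>"
    by (auto simp: eventually_at_top_linorder)
  define T where "T = max T0 1"
  define g where "g t = exp (- e * of_real t) * u t" for t
  have norm_exp: "norm (exp (- e * of_real t)) = exp (a * t)" for t
    by (simp add: norm_exp_eq_Re a_def)
  have g': "(g has_vector_derivative exp (- e * of_real t) * f t) (at t)" if "t > 0" for t
  proof -
    have "at t within {0..} = at t"
      using that by (intro at_within_interior) auto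
    then have u': "(u has_vector_derivative e * u t + f t) (at t)"
      using ode[of t] that by simp
    have E: "((\<lambda>t. exp (- e * of_real t)) has_vector_derivative - e * exp (- e * of_real t)) (at t)"
      by (rule has_vector_derivative_real_field) (auto intro!: derivative_eq_intros)
    show ?thesis
      unfolding g_def
      by (rule has_vector_derivative_eq_rhs[OF has_vector_derivative_mult[OF E u']])
         (simp add: algebra_simps)
  qed
  have phi': "((\<lambda>t. \<delta> / a * exp (a * t)) has_vector_derivative \<delta> * exp (a * t)) (at t)" for t
    using a unfolding has_real_derivative_iff_has_vector_derivative[symmetric]
    by (auto intro!: derivative_eq_intros)
  have bound: "norm (u t) \<le> norm (g T) * exp (- (a * t)) + \<epsilon> / 2" if "t > T" for t
  proof -
    have pos: "s > 0" if "s \<ge> T" for s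
      using that by (simp add: T_def)
    have "norm (g t - g T) \<le> \<delta> / a * exp (a * t) - \<delta> / a * exp (a * T)"
    proof (rule differentiable_bound_general[OF that])
      show "continuous_on {T..t} g"
        by (intro continuous_at_imp_continuous_on ballI has_vector_derivative_continuous[OF g'] pos) auto
      show "continuous_on {T..t} (\<lambda>t. \<delta> / a * exp (a * t))"
        by (intro continuous_intros)
      show "(g has_vector_derivative exp (- e * of_real s) * f s) (at s)" if "T < s" for s
        using that pos by (intro g') auto
      show "((\<lambda>t. \<delta> / a * exp (a * t)) has_vector_derivative \<delta> * exp (a * s)) (at s)" for s
        by (rule phi')
      show "norm (exp (- e * of_real s) * f s) \<le> \<delta> * exp (a * s)" if "T < s" for s
        unfolding norm_mult norm_exp using T0[of s] that
        by (simp add: T_def mult.commute less_imp_le)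
    qed
    also have "\<dots> \<le> \<epsilon> / 2 * exp (a * t)"
      using a \<open>\<epsilon> > 0\<close> by (simp add: \<delta>_def)
    finally have "norm (g t) \<le> norm (g T) + \<epsilon> / 2 * exp (a * t)"
      using norm_triangle_sub[of "g t" "g T"] by linarith
    moreover have "norm (g t) = exp (a * t) * norm (u t)"
      unfolding g_def norm_mult norm_exp by simp
    ultimately show ?thesis
      by (simp add: exp_minus field_simps)
  qed
  have "((\<lambda>t. norm (g T) * exp (- (a * t)) + \<epsilon> / 2) \<longlongrightarrow> norm (g T) * 0 + \<epsilon> / 2) at_top"
    using a by (intro tendsto_intros filterlim_compose[OF exp_at_bot]
        filterlim_compose[OF filterlim_uminus_at_bot_at_top] filterlim_tendsto_pos_mult_at_top[OF tendsto_const]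
        filterlim_ident)
  then have "eventually (\<lambda>t. norm (g T) * exp (- (a * t)) + \<epsilon> / 2 < \<epsilon>) at_top"
    by (rule order_tendstoD(2)) (use \<open>\<epsilon> > 0\<close> in simp)
  then show "eventually (\<lambda>t. dist (u t) 0 < \<epsilon>) at_top"
    using eventually_gt_at_top[of T] by eventually_elim (use bound in force)
qed

text \<open>After a Schur triangularization the last coordinate obeys a homogeneous scalar equation, and each
earlier one a scalar equation whose inhomogeneity is a combination of later coordinates. Hence the
coordinates tend to zero one after another, from the last to the first.\<close>

lemma linear_ode_decay:
  fixes F :: "complex mat" and y :: "real \<Rightarrow> complex vec"
  assumes F: "F \<in> carrier_mat n n"
    and stable: "\<And>e. eigenvalue F e \<Longrightarrow> Re e < 0"
    and y: "\<And>t. y t \<in> carrier_vec n"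
    and ode: "\<And>t i. t \<ge> 0 \<Longrightarrow> i < n \<Longrightarrow>
      ((\<lambda>t. y t $ i) has_vector_derivative (F *\<^sub>v y t) $ i) (at t within {0..})"
    and i: "i < n"
  shows "((\<lambda>t. y t $ i) \<longlongrightarrow> 0) at_top"
proof -
  obtain es where "char_poly F = (\<Prod>e\<leftarrow>es. [:- e, 1:])"
    using char_poly_factorized[OF F] by auto
  from schur_decomposition_exists[OF F this] obtain T P Q
    where T: "T \<in> carrier_mat n n" "upper_triangular T" and sim: "similar_mat_wit F T P Q"
    by (auto simp: similar_mat_def)
  note PQ = similar_mat_witD2[OF F sim]
  have QF: "Q * F = T * Q"
  proof -
    have TQ: "T * Q \<in> carrier_mat n n" using T PQ by simp
    have "Q * F = Q * (P * (T * Q))"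
      by (simp only: PQ(3) assoc_mult_mat[OF PQ(6) T(1) PQ(7)])
    also have "\<dots> = (Q * P) * (T * Q)"
      by (rule assoc_mult_mat[OF PQ(7) PQ(6) TQ, symmetric])
    also have "\<dots> = T * Q"
      by (simp only: PQ(2) left_mult_one_mat[OF TQ])
    finally show ?thesis .
  qed
  note row = mult_mat_vec_index_sum
  have T_stable: "Re (T $$ (i, i)) < 0" if "i < n" for i
  proof -
    have "T $$ (i, i) \<in> set (diag_mat T)"
      using that T by (auto simp: diag_mat_def)
    then have "poly (char_poly T) (T $$ (i, i)) = 0"
      unfolding char_poly_upper_triangular[OF T] poly_prod_list prod_list_zero_iff by auto
    also have "char_poly T = char_poly F"
      using sim by (intro char_poly_similar[symmetric]) (auto simp: similar_mat_def)
    finally show ?thesis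
      using stable eigenvalue_root_char_poly[OF F] by auto
  qed
  define u where "u t = Q *\<^sub>v y t" for t
  have u: "u t \<in> carrier_vec n" for t
    using PQ y by (simp add: u_def)
  have u': "((\<lambda>t. u t $ i) has_vector_derivative (\<Sum>j<n. T $$ (i, j) * u t $ j)) (at t within {0..})"
    if "t \<ge> 0" "i < n" for t i
  proof -
    have "((\<lambda>t. \<Sum>j<n. Q $$ (i, j) * y t $ j) has_vector_derivative
        (\<Sum>j<n. Q $$ (i, j) * (F *\<^sub>v y t) $ j)) (at t within {0..})"
      using that by (intro has_vector_derivative_sum has_vector_derivative_mult_right ode) auto
    moreover have "(\<Sum>j<n. Q $$ (i, j) * (F *\<^sub>v y t) $ j) = (\<Sum>j<n. T $$ (i, j) * u t $ j)"
    proof -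
      have "Q *\<^sub>v (F *\<^sub>v y t) = T *\<^sub>v u t"
        by (simp only: u_def assoc_mult_mat_vec[OF PQ(7) F y, symmetric] QF
            assoc_mult_mat_vec[OF T(1) PQ(7) y])
      then show ?thesis
        by (simp only: row[OF PQ(7) mult_mat_vec_carrier[OF F y] that(2), symmetric]
            row[OF T(1) u that(2), symmetric])
    qed
    ultimately show ?thesis
      using row[of Q] PQ y that by (simp add: u_def)
  qed
  have "((\<lambda>t. u t $ i) \<longlongrightarrow> 0) at_top" if "i < n" for i
    using that
  proof (induction "n - i" arbitrary: i rule: less_induct)
    case less
    have split: "(\<Sum>j<n. T $$ (i, j) * u t $ j)
        = T $$ (i, i) * u t $ i + (\<Sum>j\<in>{i<..<n}. T $$ (i, j) * u t $ j)" for t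
    proof -
      have "(\<Sum>j<n. T $$ (i, j) * u t $ j) = (\<Sum>j\<in>insert i {i<..<n}. T $$ (i, j) * u t $ j)"
        using less.prems T by (intro sum.mono_neutral_right) (auto simp: upper_triangular_def)
      then show ?thesis by simp
    qed
    have "((\<lambda>t. \<Sum>j\<in>{i<..<n}. T $$ (i, j) * u t $ j) \<longlongrightarrow> (\<Sum>j\<in>{i<..<n}. T $$ (i, j) * 0)) at_top"
      by (intro tendsto_sum tendsto_mult tendsto_const less.hyps) auto
    then have lim: "((\<lambda>t. \<Sum>j\<in>{i<..<n}. T $$ (i, j) * u t $ j) \<longlongrightarrow> 0) at_top"
      by (simp only: mult_zero_right sum.neutral_const)
    show ?case
      by (rule scalar_ode_decay[OF u'[OF _ less.prems, unfolded split] lim T_stable[OF less.prems]])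
  qed
  then have "((\<lambda>t. \<Sum>j<n. P $$ (i, j) * u t $ j) \<longlongrightarrow> (\<Sum>j<n. P $$ (i, j) * 0)) at_top"
    by (intro tendsto_sum tendsto_mult tendsto_const) auto
  moreover have "(\<Sum>j<n. P $$ (i, j) * u t $ j) = y t $ i" for t
  proof -
    have "P *\<^sub>v u t = y t"
      by (simp only: u_def assoc_mult_mat_vec[OF PQ(6,7) y, symmetric] PQ(1) one_mult_mat_vec[OF y])
    then show ?thesis
      by (simp only: row[OF PQ(6) u i, symmetric])
  qed
  ultimately show ?thesis by simp
qed

lemma mult_mat_vec_uminus:
  fixes A :: "'a :: ring mat"
  shows "A \<in> carrier_mat m n \<Longrightarrow> v \<in> carrier_vec n \<Longrightarrow> A *\<^sub>v (- v) = - (A *\<^sub>v v)"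
  by (intro eq_vecI) auto

lemma add_vec_eq_0D:
  fixes a b c :: "'a :: ab_group_add vec"
  assumes "a \<in> carrier_vec n" "b \<in> carrier_vec n" "c \<in> carrier_vec n" "a + b + c = 0\<^sub>v n"
  shows "c + b = - a"
proof (rule eq_vecI)
  fix i assume "i < dim_vec (- a)"
  then show "(c + b) $ i = (- a) $ i"
    using assms(1-3) arg_cong[OF assms(4), of "\<lambda>v. v $ i"] add_eq_0_iff[of "a $ i" "b $ i + c $ i"]
    by (simp add: ac_simps)
qed (use assms(1-3) in simp)

text \<open>With an inverse \<open>N\<close> of \<open>M\<close>, the pair of positions and velocities solves a first-order system whose
companion matrix has the roots of \<open>det (s^2 M + s B + K)\<close> as its eigenvalues.\<close>

lemma second_order_decay:
  fixes M B K :: "complex mat" and x v w :: "nat \<Rightarrow> real \<Rightarrow> complex"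
  assumes M: "M \<in> carrier_mat q q" and B: "B \<in> carrier_mat q q" and K: "K \<in> carrier_mat q q"
    and regular: "\<And>z. z \<in> carrier_vec q \<Longrightarrow> M *\<^sub>v z = 0\<^sub>v q \<Longrightarrow> z = 0\<^sub>v q"
    and stable: "\<And>s z. z \<in> carrier_vec q \<Longrightarrow> z \<noteq> 0\<^sub>v q \<Longrightarrow>
      s\<^sup>2 \<cdot>\<^sub>v (M *\<^sub>v z) + s \<cdot>\<^sub>v (B *\<^sub>v z) + K *\<^sub>v z = 0\<^sub>v q \<Longrightarrow> Re s < 0"
    and x': "\<And>t i. t \<ge> 0 \<Longrightarrow> i < q \<Longrightarrow> (x i has_vector_derivative v i t) (at t within {0..})"
    and v': "\<And>t i. t \<ge> 0 \<Longrightarrow> i < q \<Longrightarrow> (v i has_vector_derivative w i t) (at t within {0..})"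
    and eq: "\<And>t. t \<ge> 0 \<Longrightarrow> M *\<^sub>v vec q (\<lambda>i. w i t) + B *\<^sub>v vec q (\<lambda>i. v i t)
      + K *\<^sub>v vec q (\<lambda>i. x i t) = 0\<^sub>v q"
    and i: "i < q"
  shows "(x i \<longlongrightarrow> 0) at_top"
proof -
  have "det M \<noteq> 0"
    using det_0_iff_vec_prod_zero[OF M] regular by auto
  from det_non_zero_imp_unit[OF M this, of "()"] obtain N
    where N: "N \<in> carrier_mat q q" and NM: "N * M = 1\<^sub>m q" and MN: "M * N = 1\<^sub>m q"
    by (auto simp: Units_def ring_mat_def)
  define F where "F = four_block_mat (0\<^sub>m q q) (1\<^sub>m q) (- (N * K)) (- (N * B))"
  have F: "F \<in> carrier_mat (q + q) (q + q)"
    unfolding F_def using N B by (intro four_block_carrier_mat) auto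
  have F_mult: "F *\<^sub>v (a @\<^sub>v b) = b @\<^sub>v - (N *\<^sub>v (K *\<^sub>v a + B *\<^sub>v b))"
    if ab: "a \<in> carrier_vec q" "b \<in> carrier_vec q" for a b
  proof -
    have "F *\<^sub>v (a @\<^sub>v b) = (0\<^sub>m q q *\<^sub>v a + 1\<^sub>m q *\<^sub>v b)
        @\<^sub>v (- (N * K) *\<^sub>v a + - (N * B) *\<^sub>v b)"
      unfolding F_def
      by (rule four_block_mat_mult_vec[OF zero_carrier_mat one_carrier_mat _ _ ab])
         (use N K B in auto)
    also have "0\<^sub>m q q *\<^sub>v a + 1\<^sub>m q *\<^sub>v b = b"
      using ab by (intro eq_vecI) auto
    also have "- (N * K) *\<^sub>v a + - (N * B) *\<^sub>v b = - (N *\<^sub>v (K *\<^sub>v a + B *\<^sub>v b))"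
    proof -
      have "- (N * K) *\<^sub>v a = - (N *\<^sub>v (K *\<^sub>v a))" "- (N * B) *\<^sub>v b = - (N *\<^sub>v (B *\<^sub>v b))"
        using ab N K B by (auto simp: uminus_mult_mat_vec)
      moreover have "N *\<^sub>v (K *\<^sub>v a + B *\<^sub>v b) = N *\<^sub>v (K *\<^sub>v a) + N *\<^sub>v (B *\<^sub>v b)"
        using ab N K B by (intro mult_add_distrib_mat_vec) auto
      ultimately show ?thesis
        using N by (intro eq_vecI) auto
    qed
    finally show ?thesis .
  qed
  have F_stable: "Re s < 0" if ev: "eigenvalue F s" for s
  proof -
    obtain y where y: "y \<in> carrier_vec (q + q)" "y \<noteq> 0\<^sub>v (q + q)" "F *\<^sub>v y = s \<cdot>\<^sub>v y"
      using ev unfolding eigenvalue_def eigenvector_def carrier_matD(1)[OF F] by blast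
    define a b where "a = vec_first y q" and "b = vec_last y q"
    have ab: "a \<in> carrier_vec q" "b \<in> carrier_vec q" and y_ab: "y = a @\<^sub>v b"
      using y(1) by (auto simp: a_def b_def)
    have "b @\<^sub>v - (N *\<^sub>v (K *\<^sub>v a + B *\<^sub>v b)) = s \<cdot>\<^sub>v a @\<^sub>v s \<cdot>\<^sub>v b"
    proof -
      have "s \<cdot>\<^sub>v (a @\<^sub>v b) = s \<cdot>\<^sub>v a @\<^sub>v s \<cdot>\<^sub>v b"
        using ab by (intro eq_vecI) auto
      then show ?thesis
        using y(3) unfolding y_ab F_mult[OF ab] by simp
    qed
    then have b: "b = s \<cdot>\<^sub>v a" and Nb: "- (N *\<^sub>v (K *\<^sub>v a + B *\<^sub>v b)) = s \<cdot>\<^sub>v b"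
      using ab by (auto simp: append_vec_eq[of _ q])
    have "M *\<^sub>v (- (N *\<^sub>v (K *\<^sub>v a + B *\<^sub>v b))) = - (K *\<^sub>v a + B *\<^sub>v b)"
    proof -
      have c: "K *\<^sub>v a + B *\<^sub>v b \<in> carrier_vec q" using K B ab by simp
      then have "M *\<^sub>v (N *\<^sub>v (K *\<^sub>v a + B *\<^sub>v b)) = K *\<^sub>v a + B *\<^sub>v b"
        by (simp only: assoc_mult_mat_vec[OF M N c, symmetric] MN one_mult_mat_vec[OF c])
      then show ?thesis
        using mult_mat_vec_uminus[OF M mult_mat_vec_carrier[OF N c]] by simp
    qed
    moreover have "M *\<^sub>v (s \<cdot>\<^sub>v b) = s\<^sup>2 \<cdot>\<^sub>v (M *\<^sub>v a)"
      using M ab by (simp add: b mult_mat_vec smult_smult_assoc power2_eq_square)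
    moreover have "B *\<^sub>v b = s \<cdot>\<^sub>v (B *\<^sub>v a)"
      using B ab by (simp add: b mult_mat_vec)
    ultimately have eq_a: "s\<^sup>2 \<cdot>\<^sub>v (M *\<^sub>v a) = - (K *\<^sub>v a + s \<cdot>\<^sub>v (B *\<^sub>v a))"
      using Nb by simp
    have "s\<^sup>2 \<cdot>\<^sub>v (M *\<^sub>v a) + s \<cdot>\<^sub>v (B *\<^sub>v a) + K *\<^sub>v a = 0\<^sub>v q"
      unfolding eq_a using ab B K by (intro eq_vecI) auto
    moreover have "a \<noteq> 0\<^sub>v q"
    proof
      assume "a = 0\<^sub>v q"
      then have "y = 0\<^sub>v (q + q)" unfolding y_ab b by (auto intro!: eq_vecI)
      then show False using y(2) by simp
    qed
    ultimately show ?thesis using stable[OF ab(1)] by simp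
  qed
  define X V W where "X t = vec q (\<lambda>i. x i t)" and "V t = vec q (\<lambda>i. v i t)"
    and "W t = vec q (\<lambda>i. w i t)" for t
  have car: "X t \<in> carrier_vec q" "V t \<in> carrier_vec q" "W t \<in> carrier_vec q" for t
    by (auto simp: X_def V_def W_def)
  have F_XV: "F *\<^sub>v (X t @\<^sub>v V t) = V t @\<^sub>v W t" if "t \<ge> 0" for t
  proof -
    have "K *\<^sub>v X t + B *\<^sub>v V t = - (M *\<^sub>v W t)"
      using add_vec_eq_0D[OF _ _ _ eq[OF that]] M B K by (simp add: X_def V_def W_def)
    then have "N *\<^sub>v (K *\<^sub>v X t + B *\<^sub>v V t) = - (N *\<^sub>v (M *\<^sub>v W t))"
      using mult_mat_vec_uminus[OF N mult_mat_vec_carrier[OF M car(3)]] by simp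
    also have "N *\<^sub>v (M *\<^sub>v W t) = W t"
      by (simp only: assoc_mult_mat_vec[OF N M car(3), symmetric] NM one_mult_mat_vec[OF car(3)])
    finally show ?thesis
      using car by (simp add: F_mult)
  qed
  have "((\<lambda>t. (X t @\<^sub>v V t) $ j) has_vector_derivative (F *\<^sub>v (X t @\<^sub>v V t)) $ j) (at t within {0..})"
    if "t \<ge> 0" "j < q + q" for t j
    unfolding F_XV[OF that(1)]
    using that x'[OF that(1), of j] v'[OF that(1), of "j - q"]
    by (cases "j < q") (auto simp: X_def V_def W_def)
  then have "((\<lambda>t. (X t @\<^sub>v V t) $ i) \<longlongrightarrow> 0) at_top"
    using linear_ode_decay[OF F F_stable, of "\<lambda>t. X t @\<^sub>v V t" i] car i by simp
  then show ?thesis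
    using i by (simp add: X_def V_def)
qed

section \<open>Synchronization\<close>

text \<open>The solution is \<open>cos (sqrt \<mu> t) f (z i)\<close>, where the projection \<open>f\<close> to a real or imaginary part is
chosen so that two entries of \<open>z\<close> remain distinct; at the multiples of the period their
distance keeps its initial value.\<close>

lemma not_synchronize_if_vibration:
  assumes silent: "silent_mode q b z" and mu: "\<mu> > 0"
    and vib: "\<forall>i<q. k0 *\<^sub>R z i + coupling q k z i = \<mu> *\<^sub>R (m0 *\<^sub>R z i + coupling q m z i)"
  shows "\<not> synchronize q m0 k0 m b k"
proof
  assume sync: "synchronize q m0 k0 m b k"
  obtain i where i: "i < q" "z i \<noteq> 0" using silent by (auto simp: silent_mode_def)
  \<comment> \<open>A constant vector whose entries sum to zero is zero.\<close>
  have "\<exists>j<q. z j \<noteq> z i"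
  proof (rule ccontr)
    assume "\<not> (\<exists>j<q. z j \<noteq> z i)"
    then have "(\<Sum>j<q. z j) = (\<Sum>j<q. z i)" by (intro sum.cong) auto
    then show False using silent i by (auto simp: silent_mode_def)
  qed
  then obtain j where j: "j < q" "z j \<noteq> z i" by auto
  have "\<exists>f :: complex \<Rightarrow> real. linear f \<and> f (z i) \<noteq> f (z j)"
    using j(2) complex_eq_iff[of "z j" "z i"]
      bounded_linear.linear[OF bounded_linear_Re] bounded_linear.linear[OF bounded_linear_Im]
    by metis
  then obtain f :: "complex \<Rightarrow> real" where f: "linear f" "f (z i) \<noteq> f (z j)" by blast
  define r where "r = sqrt \<mu>"
  have r: "r > 0" "r * r = \<mu>" using mu by (simp_all add: r_def)
  define x v w where "x i t = cos (r * t) * f (z i)"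
    and "v i t = - r * sin (r * t) * f (z i)"
    and "w i t = - \<mu> * cos (r * t) * f (z i)" for i t
  have C: "(\<Sum>j<q. a i j * (c * f (z i) - c * f (z j))) = c * f (coupling q a z i)" for a c i
  proof -
    have "(\<Sum>j<q. a i j * (c * f (z i) - c * f (z j))) = coupling q a (\<lambda>j. c *\<^sub>R f (z j)) i"
      by (simp add: coupling_def)
    then show ?thesis
      unfolding coupling_scaleR coupling_linear[OF f(1)] by simp
  qed
  have "oscillator_solution q m0 k0 m b k x"
    unfolding oscillator_solution_def
  proof (rule exI[of _ v], rule exI[of _ w], intro allI impI conjI)
    fix t i assume i: "i < q"
    show "(x i has_real_derivative v i t) (at t within {0..})"
      unfolding x_def[abs_def] v_def by (auto intro!: derivative_eq_intros)
    show "(v i has_real_derivative w i t) (at t within {0..})"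
      unfolding v_def[abs_def] w_def r(2)[symmetric] by (auto intro!: derivative_eq_intros)
    have "f (k0 *\<^sub>R z i + coupling q k z i) = f (\<mu> *\<^sub>R (m0 *\<^sub>R z i + coupling q m z i))"
      using vib i by simp
    then have f_vib: "k0 * f (z i) + f (coupling q k z i) = \<mu> * (m0 * f (z i) + f (coupling q m z i))"
      by (simp add: linear_add[OF f(1)] linear_scale[OF f(1)])
    have f_silent: "f (coupling q b z i) = 0"
      using silent i linear_0[OF f(1)] by (simp add: silent_mode_def)
    have "m0 * w i t + k0 * x i t + (\<Sum>j<q. m i j * (w i t - w j t))
        + (\<Sum>j<q. b i j * (v i t - v j t)) + (\<Sum>j<q. k i j * (x i t - x j t))
      = cos (r * t) * ((k0 * f (z i) + f (coupling q k z i))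
          - \<mu> * (m0 * f (z i) + f (coupling q m z i)))"
      unfolding x_def v_def w_def C f_silent by (simp add: algebra_simps)
    then show "m0 * w i t + k0 * x i t + (\<Sum>j<q. m i j * (w i t - w j t))
        + (\<Sum>j<q. b i j * (v i t - v j t)) + (\<Sum>j<q. k i j * (x i t - x j t)) = 0"
      unfolding f_vib by simp
  qed
  then have "((\<lambda>t. \<bar>x i t - x j t\<bar>) \<longlongrightarrow> 0) at_top"
    using sync i j by (simp add: synchronize_def)
  moreover have "filterlim (\<lambda>n. 2 * pi / r * real n) at_top sequentially"
    using r by (intro filterlim_tendsto_pos_mult_at_top[OF tendsto_const] filterlim_real_sequentially) auto
  ultimately have "((\<lambda>n. \<bar>x i (2 * pi / r * real n) - x j (2 * pi / r * real n)\<bar>) \<longlongrightarrow> 0) sequentially"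
    by (rule filterlim_compose)
  moreover have "x i (2 * pi / r * real n) = f (z i)" for i n
    using r cos_int_2pin[of n] by (simp add: x_def field_simps)
  ultimately have "((\<lambda>n :: nat. \<bar>f (z i) - f (z j)\<bar>) \<longlongrightarrow> 0) sequentially" by simp
  then show False using f(2) by (simp add: LIMSEQ_const_iff)
qed

text \<open>Real and imaginary part give \<open>((Re s)^2 - (Im s)^2) a + (Re s) b + c = 0\<close> and
\<open>Im s (2 a Re s + b) = 0\<close>. The first excludes real roots \<open>s \<ge> 0\<close>, and then the second makes two
nonnegative terms cancel.\<close>

lemma nonneg_root_of_damped_quadratic:
  fixes s :: complex
  assumes root: "s\<^sup>2 * of_real a + s * of_real b + of_real c = 0"
    and pos: "a > 0" "b \<ge> 0" "c > 0" and s: "Re s \<ge> 0"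
  shows "b = 0" "Re s = 0" "Im s \<noteq> 0"
proof -
  have re: "((Re s)\<^sup>2 - (Im s)\<^sup>2) * a + Re s * b + c = 0"
    and im: "Im s * (2 * Re s * a + b) = 0"
    using arg_cong[OF root, of Re] arg_cong[OF root, of Im]
    by (simp_all add: power2_eq_square algebra_simps)
  show "Im s \<noteq> 0"
  proof
    assume "Im s = 0"
    moreover have "(Re s)\<^sup>2 * a + Re s * b + c > 0"
      using pos s by (intro add_nonneg_pos add_nonneg_nonneg mult_nonneg_nonneg) auto
    ultimately show False using re by simp
  qed
  then have "2 * Re s * a + b = 0" using im by simp
  moreover have "2 * Re s * a \<ge> 0" using pos s by simp
  ultimately show "b = 0" using pos by linarith
  then show "Re s = 0" using \<open>2 * Re s * a + b = 0\<close> pos by simp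
qed

text \<open>The coefficient matrices of acceleration and position in the equations of motion.\<close>

definition shifted_lap :: "nat \<Rightarrow> real \<Rightarrow> (nat \<Rightarrow> nat \<Rightarrow> real) \<Rightarrow> complex mat" where
  "shifted_lap q c a = complex_of_real c \<cdot>\<^sub>m 1\<^sub>m q + complex_lap q a"

lemma shifted_lap_carrier: "shifted_lap q c a \<in> carrier_mat q q"
  by (simp add: shifted_lap_def)

lemma shifted_lap_mult_vec:
  assumes a: "weights q a" and z: "z \<in> carrier_vec q" and i: "i < q"
  shows "(shifted_lap q c a *\<^sub>v z) $ i = c *\<^sub>R z $ i + coupling q a (($) z) i"
proof -
  have "(shifted_lap q c a *\<^sub>v z) $ i
      = (\<Sum>j<q. (if i = j then of_real c * z $ i else 0) + complex_lap q a $$ (i, j) * z $ j)"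
    unfolding mult_mat_vec_index_sum[OF shifted_lap_carrier z i] using i
    by (intro sum.cong) (auto simp: shifted_lap_def lap_def algebra_simps)
  also have "\<dots> = of_real c * z $ i + (\<Sum>j<q. complex_lap q a $$ (i, j) * z $ j)"
    using i by (simp add: sum.distrib)
  finally show ?thesis
    by (simp only: complex_lap_sum[OF a i] scaleR_conv_of_real)
qed

lemma lap_add_ones_mult_vec:
  assumes a: "weights q a" and z: "z \<in> carrier_vec q" and i: "i < q"
  shows "((complex_lap q a + ones q) *\<^sub>v z) $ i = coupling q a (($) z) i + (\<Sum>j<q. z $ j)"
proof -
  have "(complex_lap q a + ones q) *\<^sub>v z = complex_lap q a *\<^sub>v z + ones q *\<^sub>v z"
    using z by (intro add_mult_distrib_mat_vec[of _ q q]) auto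
  then show ?thesis
    using complex_lap_mult_vec[OF a i z] ones_mult_vec[OF z i] i by (simp del: index_mult_mat_vec)
qed

definition shifted_form :: "nat \<Rightarrow> real \<Rightarrow> (nat \<Rightarrow> nat \<Rightarrow> real) \<Rightarrow> (nat \<Rightarrow> complex) \<Rightarrow> real" where
  "shifted_form q c a z = c * (\<Sum>i<q. (cmod (z i))\<^sup>2) + dirichlet q a z"

lemma shifted_form_pairing:
  assumes "weights q a"
  shows "(\<Sum>i<q. cnj (z i) * (c *\<^sub>R z i + coupling q a z i)) = of_real (shifted_form q c a z)"
proof -
  have "(\<Sum>i<q. cnj (z i) * (c *\<^sub>R z i + coupling q a z i))
      = of_real c * (\<Sum>i<q. cnj (z i) * z i) + (\<Sum>i<q. cnj (z i) * coupling q a z i)"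
    by (simp add: sum_distrib_left sum.distrib algebra_simps scaleR_conv_of_real)
  then show ?thesis
    by (simp add: shifted_form_def sum_cnj_mult_self coupling_pairing_self[OF assms])
qed

lemma shifted_form_pos:
  assumes "weights q a" "c > 0" "i < q" "z i \<noteq> 0"
  shows "shifted_form q c a z > 0"
  unfolding shifted_form_def
  using sum_norm_square_pos[of i q z] dirichlet_nonneg[OF assms(1), of z] assms
  by (intro add_pos_nonneg mult_pos_pos) auto

lemma nonzero_entry:
  fixes z :: "'a :: zero Matrix.vec"
  assumes "z \<in> carrier_vec q" "z \<noteq> 0\<^sub>v q"
  obtains i where "i < q" "z $ i \<noteq> 0"
  using assms by (auto simp: vec_eq_iff)

lemma shifted_lap_regular:
  assumes a: "weights q a" and c: "c > 0"
    and z: "z \<in> carrier_vec q" and kernel: "shifted_lap q c a *\<^sub>v z = 0\<^sub>v q"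
  shows "z = 0\<^sub>v q"
proof (rule ccontr)
  assume "z \<noteq> 0\<^sub>v q"
  then obtain i where i: "i < q" "z $ i \<noteq> 0" using nonzero_entry[OF z] by blast
  have "c *\<^sub>R z $ i + coupling q a (($) z) i = 0" if "i < q" for i
    using shifted_lap_mult_vec[OF a z that, of c] that unfolding kernel by simp
  then have "(\<Sum>i<q. cnj (z $ i) * (c *\<^sub>R z $ i + coupling q a (($) z) i)) = 0"
    by simp
  then show False
    using shifted_form_pos[where z = "($) z", OF a c i]
    unfolding shifted_form_pairing[OF a] of_real_eq_0_iff by simp
qed

text \<open>Energy balance: pairing the equation with \<open>z\<close> makes \<open>s\<close> a root of a real quadratic with positive
outer coefficients and the damping form in the middle. With \<open>Re s \<ge> 0\<close> the damping form must vanish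
and \<open>s\<close> must be imaginary, so that \<open>s^2 = - (Im s)^2\<close> turns the equation into that of an undamped
vibration.\<close>

lemma vibration_of_unstable_root:
  assumes pos: "m0 > 0" "k0 > 0"
    and w: "weights q m" "weights q b" "weights q k"
    and z: "z \<in> carrier_vec q" "z \<noteq> 0\<^sub>v q" and s: "Re s \<ge> 0"
    and root: "s\<^sup>2 \<cdot>\<^sub>v (shifted_lap q m0 m *\<^sub>v z) + s \<cdot>\<^sub>v ((complex_lap q b + ones q) *\<^sub>v z)
      + shifted_lap q k0 k *\<^sub>v z = 0\<^sub>v q"
  shows "silent_mode q b (($) z)" "Im s \<noteq> 0"
    and "\<forall>i<q. k0 *\<^sub>R z $ i + coupling q k (($) z) i
      = (Im s)\<^sup>2 *\<^sub>R (m0 *\<^sub>R z $ i + coupling q m (($) z) i)"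
proof -
  define y where "y = ($) z"
  obtain i where i: "i < q" "y i \<noteq> 0" using nonzero_entry[OF z] by (auto simp: y_def)
  have eq: "s\<^sup>2 * (m0 *\<^sub>R y i + coupling q m y i) + s * (coupling q b y i + (\<Sum>j<q. y j))
      + (k0 *\<^sub>R y i + coupling q k y i) = 0" if "i < q" for i
    using arg_cong[OF root, of "\<lambda>v. v $ i"] that
      shifted_lap_carrier[of q m0 m] shifted_lap_carrier[of q k0 k]
      shifted_lap_mult_vec[OF w(1) z(1) that] shifted_lap_mult_vec[OF w(3) z(1) that]
      lap_add_ones_mult_vec[OF w(2) z(1) that]
    by (simp add: y_def del: index_mult_mat_vec)
  have "s\<^sup>2 * (\<Sum>i<q. cnj (y i) * (m0 *\<^sub>R y i + coupling q m y i))
      + s * (\<Sum>i<q. cnj (y i) * (coupling q b y i + (\<Sum>j<q. y j)))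
      + (\<Sum>i<q. cnj (y i) * (k0 *\<^sub>R y i + coupling q k y i))
    = (\<Sum>i<q. cnj (y i) * (s\<^sup>2 * (m0 *\<^sub>R y i + coupling q m y i)
        + s * (coupling q b y i + (\<Sum>j<q. y j)) + (k0 *\<^sub>R y i + coupling q k y i)))"
    unfolding sum_distrib_left[of "s\<^sup>2"]
      sum_distrib_left[of s "\<lambda>i. cnj (y i) * (coupling q b y i + (\<Sum>j<q. y j))"]
      sum.distrib[symmetric]
    by (intro sum.cong refl) (simp only: distrib_left mult.left_commute)
  also have "\<dots> = 0" by (simp add: eq)
  finally have quad: "s\<^sup>2 * of_real (shifted_form q m0 m y) + s * of_real (damping_form q b y)
      + of_real (shifted_form q k0 k y) = 0"
    unfolding shifted_form_pairing[OF w(1)] shifted_form_pairing[OF w(3)]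
      damping_form_pairing[OF w(2)] .
  note imag = nonneg_root_of_damped_quadratic[OF quad
      shifted_form_pos[where z = y, OF w(1) pos(1) i] damping_form_nonneg[OF w(2)]
      shifted_form_pos[where z = y, OF w(3) pos(2) i] s]
  have silent: "silent_mode q b y"
    by (rule silent_mode_if_damping_form_eq_0[OF w(2) imag(1) i])
  then show "silent_mode q b (($) z)" by (simp only: y_def)
  show "Im s \<noteq> 0" by (rule imag(3))
  have s2: "s\<^sup>2 = - of_real ((Im s)\<^sup>2)"
    using imag(2) by (simp add: complex_eq_iff power2_eq_square)
  have "k0 *\<^sub>R y i + coupling q k y i = (Im s)\<^sup>2 *\<^sub>R (m0 *\<^sub>R y i + coupling q m y i)" if "i < q" for i
    using eq[OF that] silent that unfolding s2
    by (simp add: silent_mode_def scaleR_conv_of_real[of "(Im s)\<^sup>2"])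
  then show "\<forall>i<q. k0 *\<^sub>R z $ i + coupling q k (($) z) i
      = (Im s)\<^sup>2 *\<^sub>R (m0 *\<^sub>R z $ i + coupling q m (($) z) i)"
    by (simp add: y_def)
qed

text \<open>The deviations from the mean satisfy the equations of motion: the couplings only involve
differences, and the mean itself moves like a single free oscillator. As deviations sum to zero,
adding \<open>ones\<close> to the damping matrix changes nothing for them, but it removes the undamped common
motion from the spectrum.\<close>

lemma synchronize_if_no_vibration:
  assumes q: "q > 0" and pos: "m0 > 0" "k0 > 0"
    and w: "weights q m" "weights q b" "weights q k"
    and none: "\<And>z \<mu>. silent_mode q b z \<Longrightarrow> \<mu> > 0 \<Longrightarrow>
      \<forall>i<q. k0 *\<^sub>R z i + coupling q k z i = \<mu> *\<^sub>R (m0 *\<^sub>R z i + coupling q m z i) \<Longrightarrow> False"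
  shows "synchronize q m0 k0 m b k"
  unfolding synchronize_def
proof (intro allI impI)
  fix x i j assume sol: "oscillator_solution q m0 k0 m b k x" and i: "i < q" and j: "j < q"
  have stable: "Re s < 0"
    if z: "z \<in> carrier_vec q" "z \<noteq> 0\<^sub>v q"
      and root: "s\<^sup>2 \<cdot>\<^sub>v (shifted_lap q m0 m *\<^sub>v z) + s \<cdot>\<^sub>v ((complex_lap q b + ones q) *\<^sub>v z)
        + shifted_lap q k0 k *\<^sub>v z = 0\<^sub>v q" for s z
  proof (rule ccontr)
    assume "\<not> Re s < 0"
    then have "Re s \<ge> 0" by simp
    note vib = vibration_of_unstable_root[OF pos w z this root]
    show False
      using none[OF vib(1) _ vib(3)] vib(2) by simp
  qed
  obtain v a where
    x': "\<And>t i. t \<ge> 0 \<Longrightarrow> i < q \<Longrightarrow> (x i has_real_derivative v i t) (at t within {0..})" and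
    v': "\<And>t i. t \<ge> 0 \<Longrightarrow> i < q \<Longrightarrow> (v i has_real_derivative a i t) (at t within {0..})" and
    eq: "\<And>t i. t \<ge> 0 \<Longrightarrow> i < q \<Longrightarrow> m0 * a i t + k0 * x i t
      + coupling q m (\<lambda>j. a j t) i + coupling q b (\<lambda>j. v j t) i + coupling q k (\<lambda>j. x j t) i = 0"
    using sol unfolding oscillator_solution_def coupling_def real_scaleR_def by blast
  define mean where "mean y t = (\<Sum>j<q. y j t) / real q" for y :: "nat \<Rightarrow> real \<Rightarrow> real" and t
  define dev where "dev y i t = complex_of_real (y i t - mean y t)" for y i t
  \<comment> \<open>Couplings are internal forces, so they cancel in the sum over all oscillators.\<close>
  have mean_eq: "m0 * mean a t + k0 * mean x t = 0" if "t \<ge> 0" for t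
  proof -
    have "(\<Sum>i<q. m0 * a i t + k0 * x i t + coupling q m (\<lambda>j. a j t) i
        + coupling q b (\<lambda>j. v j t) i + coupling q k (\<lambda>j. x j t) i) = 0"
      using eq[OF that] by simp
    then have "m0 * (\<Sum>i<q. a i t) + k0 * (\<Sum>i<q. x i t) = 0"
      by (simp add: sum.distrib sum_coupling w sum_distrib_left)
    then have "(m0 * (\<Sum>i<q. a i t) + k0 * (\<Sum>i<q. x i t)) / real q = 0" by simp
    then show ?thesis by (simp add: mean_def add_divide_distrib)
  qed
  have dev': "(dev y i has_vector_derivative dev y' i t) (at t within {0..})"
    if "\<And>j. j < q \<Longrightarrow> (y j has_real_derivative y' j t) (at t within {0..})" "i < q" for y y' i t
  proof -
    have "((\<lambda>t. y i t - mean y t) has_real_derivative y' i t - mean y' t) (at t within {0..})"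
      unfolding mean_def using that by (intro DERIV_diff DERIV_cdivide DERIV_sum) auto
    then show ?thesis
      unfolding dev_def[abs_def] has_real_derivative_iff_has_vector_derivative
      by (rule bounded_linear.has_vector_derivative[OF bounded_linear_of_real])
  qed
  have sum_dev: "(\<Sum>i<q. dev y i t) = 0" for y t
    using q by (simp add: dev_def mean_def sum_subtractf flip: of_real_sum)
  have coupling_dev: "coupling q c (\<lambda>j. dev y j t) i = of_real (coupling q c (\<lambda>j. y j t) i)" for c y i t
    unfolding dev_def coupling_linear[OF bounded_linear.linear[OF bounded_linear_of_real], symmetric]
      coupling_const_diff ..
  have coupling_vec: "coupling q c (($) (vec q z)) i = coupling q c z i" if "i < q"
    for c i and z :: "nat \<Rightarrow> complex"
    using that by (intro coupling_cong) auto
  have dev_eq: "shifted_lap q m0 m *\<^sub>v vec q (\<lambda>i. dev a i t) + (complex_lap q b + ones q) *\<^sub>v vec q (\<lambda>i. dev v i t)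
      + shifted_lap q k0 k *\<^sub>v vec q (\<lambda>i. dev x i t) = 0\<^sub>v q" if t: "t \<ge> 0" for t
  proof (rule eq_vecI)
    fix i assume "i < dim_vec (0\<^sub>v q :: complex vec)"
    then have i: "i < q" by simp
    have "(shifted_lap q m0 m *\<^sub>v vec q (\<lambda>i. dev a i t) + (complex_lap q b + ones q) *\<^sub>v vec q (\<lambda>i. dev v i t)
        + shifted_lap q k0 k *\<^sub>v vec q (\<lambda>i. dev x i t)) $ i
      = of_real m0 * dev a i t + coupling q m (\<lambda>j. dev a j t) i
        + (coupling q b (\<lambda>j. dev v j t) i + (\<Sum>j<q. dev v j t))
        + (of_real k0 * dev x i t + coupling q k (\<lambda>j. dev x j t) i)"
      using i shifted_lap_carrier[of q m0 m] shifted_lap_carrier[of q k0 k]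
      by (simp add: shifted_lap_mult_vec w lap_add_ones_mult_vec coupling_vec scaleR_conv_of_real
          del: index_mult_mat_vec)
    also have "\<dots> = of_real ((m0 * a i t + k0 * x i t + coupling q m (\<lambda>j. a j t) i
        + coupling q b (\<lambda>j. v j t) i + coupling q k (\<lambda>j. x j t) i) - (m0 * mean a t + k0 * mean x t))"
      unfolding coupling_dev sum_dev by (simp add: dev_def algebra_simps)
    also have "\<dots> = 0"
      by (simp only: eq[OF t i] mean_eq[OF t]) simp
    finally show "(shifted_lap q m0 m *\<^sub>v vec q (\<lambda>i. dev a i t) + (complex_lap q b + ones q) *\<^sub>v vec q (\<lambda>i. dev v i t)
        + shifted_lap q k0 k *\<^sub>v vec q (\<lambda>i. dev x i t)) $ i = 0\<^sub>v q $ i"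
      using i by simp
  qed (use shifted_lap_carrier[of q k0 k] in simp)
  have damped: "complex_lap q b + ones q \<in> carrier_mat q q" by simp
  have "(dev x i \<longlongrightarrow> 0) at_top" if "i < q" for i
    by (rule second_order_decay[OF shifted_lap_carrier damped shifted_lap_carrier
        shifted_lap_regular[OF w(1) pos(1)] stable dev'[OF x'] dev'[OF v'] dev_eq that])
  from tendsto_diff[OF this[OF i] this[OF j]]
  have "((\<lambda>t. dev x i t - dev x j t) \<longlongrightarrow> 0) at_top" by simp
  then have "((\<lambda>t. norm (dev x i t - dev x j t)) \<longlongrightarrow> 0) at_top"
    by (rule tendsto_norm_zero)
  moreover have "norm (dev x i t - dev x j t) = \<bar>x i t - x j t\<bar>" for t
    unfolding dev_def of_real_diff[symmetric] norm_of_real by simp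
  ultimately show "((\<lambda>t. \<bar>x i t - x j t\<bar>) \<longlongrightarrow> 0) at_top" by simp
qed

theorem theorem3:
  fixes q :: nat and m0 k0 :: real and m b k :: "nat \<Rightarrow> nat \<Rightarrow> real"
  assumes "q \<ge> 2" and "m0 > 0" and "k0 > 0"
    and "\<And>i j. i < q \<Longrightarrow> j < q \<Longrightarrow> m i j = m j i \<and> m i j \<ge> 0"
    and "\<And>i j. i < q \<Longrightarrow> j < q \<Longrightarrow> b i j = b j i \<and> b i j \<ge> 0"
    and "\<And>i j. i < q \<Longrightarrow> j < q \<Longrightarrow> k i j = k j i \<and> k i j \<ge> 0"
    and "\<And>i. i < q \<Longrightarrow> m i i = 0 \<and> b i i = 0 \<and> k i i = 0"
    and "edge_isolated (edges q m) (edges q k)"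
  shows "synchronize q m0 k0 m b k \<longleftrightarrow>
    Re (eig 2 (map_mat complex_of_real (lap q b)
          + \<i> \<cdot>\<^sub>m map_mat complex_of_real (lap q k - lap q m))) > 0"
proof -
  have w: "weights q m" "weights q b" "weights q k"
    using assms(4-7) unfolding weights_def by blast+
  have row_sums: "(\<Sum>j<q. interconnection q m b k $$ (i, j)) = 0" if "i < q" for i
    using interconnection_sum[OF w that, of "\<lambda>_. 1"] by (simp add: coupling_def)
  have "Re (eig 2 (interconnection q m b k)) > 0 \<longleftrightarrow>
      (\<forall>e. eigenvalue (interconnection q m b k + ones q) e \<longrightarrow> Re e > 0)"
    by (rule Re_eig_2_pos_iff[OF interconnection_carrier assms(1)]) (rule row_sums)
  also have "\<dots> \<longleftrightarrow> \<not> (\<exists>e. eigenvalue (interconnection q m b k + ones q) e \<and> Re e \<le> 0)"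
    by (auto simp: not_le)
  also have "\<dots> \<longleftrightarrow> \<not> (\<exists>z. silent_mode q b z \<and> (\<exists>\<mu>>0. \<forall>i<q.
      k0 *\<^sub>R z i + coupling q k z i = \<mu> *\<^sub>R (m0 *\<^sub>R z i + coupling q m z i)))"
    unfolding interconnection_eigenvalue_iff[OF w]
      vibration_iff_eigenvector[OF w(1,3) assms(8,2,3)] ..
  also have "\<dots> \<longleftrightarrow> synchronize q m0 k0 m b k"
    using not_synchronize_if_vibration synchronize_if_no_vibration[OF _ assms(2,3) w] assms(1)
    by (metis gr0I not_numeral_le_zero)
  finally show ?thesis
    unfolding interconnection_def by simp
qed

end
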